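(* Let $\mathcal{A},\mathcal{B}$ be multi-matrix algebras, $X$ a finite set, $\sigma\in\mathcal{A}$ a state, and $\mathcal{F}:\mathcal{A}\to\mathcal{B}\otimes\mathbb{C}^X$ an instrument, i.e. a CPTP map, written $\mathcal{F}(A)=\sum_{x\in X}\mathcal{F}_x(A)\otimes\delta_x$ with each $\mathcal{F}_x:\mathcal{A}\to\mathcal{B}$ completely positive. Let $\mathcal{E}=\mathrm{tr}\otimes\mathrm{id}_{\mathbb{C}^X}:\mathcal{B}\otimes\mathbb{C}^X\to\mathbb{C}^X$ be the partial trace, and set $\rho=\mathcal{F}(\sigma)$. Suppose $\mathrm{tr}(\mathcal{F}_x(\sigma))\neq 0$ for all $x\in X$. Define the following maps. 1. $\Psi:\mathbb{C}^X\to\mathcal{B}\otimes\mathbb{C}^X$ is the state-update map, the unique linear extension of $$\Psi(\delta_x)=\frac{\mathcal{F}_x(\sigma)}{\mathrm{tr}(\mathcal{F}_x(\sigma))}\otimes\delta_x .$$ 2. $\mathcal{E}^{\star}_{\rho}:\mathbb{C}^X\to\mathcal{B}\otimes\mathbb{C}^X$ is the Bayesian inverse of $(\mathcal{E},\rho)$ associated with any state over time function $\star$ satisfying the classical limit axiom. 3. $\Omega:\mathbb{C}^X\to\mathcal{B}\otimes\mathbb{C}^X$ is the Hilbert–Schmidt adjoint of a state-preserving conditional expectation associated with the map $\mathcal{E}$ and the state $\rho$, i.e. $\Omega$ is a CPTP map with $\Omega(\mathcal{E}(\rho))=\rho$ and $\mathcal{E}\circ\Omega=\mathrm{id}_{\mathbb{C}^X}$.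 Then $\Omega=\Psi=\mathcal{E}^{\star}_{\rho}$.
   Context: A multi-matrix algebra is a finite direct sum $\mathcal{A}=\bigoplus_{x\in X}\mathbb{M}_{m_x}$ of complex matrix algebras ($X$ a finite set, $m_x$ positive integers), with componentwise multiplication and componentwise conjugate transpose $\dagger$; $1_{\mathcal{A}}$ is its unit and $\mathrm{tr}(A)=\sum_x\mathrm{tr}(A_x)$ its (un-normalized) trace. A state (density matrix) is a positive element of trace $1$; $\mathcal{S}(\mathcal{A})$ is the set of states. $\mathrm{CPTP}(\mathcal{A},\mathcal{B})$ is the set of completely positive trace-preserving linear maps $\mathcal{A}\to\mathcal{B}$. $\mathbb{C}^X=\bigoplus_{x\in X}\mathbb{C}$, and $\delta_x\in\mathbb{C}^X$ is the unit vector with $x$ component $1$ and other components $0$. The Hilbert–Schmidt adjoint $\Phi^*:\mathcal{B}\to\mathcal{A}$ of a linear map $\Phi:\mathcal{A}\to\mathcal{B}$ is defined by $\mathrm{tr}(\Phi(A)^{\dagger}B)=\mathrm{tr}(A^{\dagger}\Phi^*(B))$. Let $\mu_{\mathcal{A}}:\mathcal{A}\otimes\mathcal{A}\to\mathcal{A}$ be the multiplication map $A_1\otimes A_2\mapsto A_1A_2$. The channel state of a linear map $\Phi:\mathcal{A}\to\mathcal{B}$ is $\mathscr{D}[\Phi]=(\mathrm{id}_{\mathcal{A}}\otimes\Phi)(\mu_{\mathcal{A}}^*(1_{\mathcal{A}}))\in\mathcal{A}\otimes\mathcal{B}$. A state over time function $\star$ associates to every pair $(\mathcal{A},\mathcal{B})$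 of multi-matrix algebras a map $\mathrm{CPTP}(\mathcal{A},\mathcal{B})\times\mathcal{S}(\mathcal{A})\to\mathcal{A}\otimes\mathcal{B}$, $(\Phi,\rho)\mapsto\Phi\star\rho$, such that $\mathrm{tr}_{\mathcal{B}}(\Phi\star\rho)=\rho$ and $\mathrm{tr}_{\mathcal{A}}(\Phi\star\rho)=\Phi(\rho)$, where $\mathrm{tr}_{\mathcal{B}}:\mathcal{A}\otimes\mathcal{B}\to\mathcal{A}$ and $\mathrm{tr}_{\mathcal{A}}:\mathcal{A}\otimes\mathcal{B}\to\mathcal{B}$ are the partial traces. It satisfies the classical limit axiom iff, for all multi-matrix algebras $\mathcal{A},\mathcal{B}$, all $\rho\in\mathcal{S}(\mathcal{A})$ and all $\Phi\in\mathrm{CPTP}(\mathcal{A},\mathcal{B})$, the condition $[\mathscr{D}[\Phi],\rho\otimes 1_{\mathcal{B}}]=0$ implies $\Phi\star\rho=\mathscr{D}[\Phi](\rho\otimes 1_{\mathcal{B}})$. A Bayesian inverse of $(\Phi,\rho)$, with $\Phi\in\mathrm{CPTP}(\mathcal{A},\mathcal{B})$ and $\rho\in\mathcal{S}(\mathcal{A})$, with respect to $\star$ is a CPTP map $\Phi^{\star}_{\rho}:\mathcal{B}\to\mathcal{A}$ such that $\Phi\star\rho=\tau(\Phi^{\star}_{\rho}\star\Phi(\rho))$, where $\tau:\mathcal{B}\otimes\mathcal{A}\to\mathcal{A}\otimes\mathcal{B}$ is the unique conjugate-linear map with $\tau(B\otimes A)=A^{\dagger}\otimes B^{\dagger}$.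 In the situation of the claim, a Bayesian inverse of $(\mathcal{E},\rho)$ exists and is unique. *)

theory Defs
  imports Complex_Main "HOL-Library.FuncSet" "Jordan_Normal_Form.Schur_Decomposition"
begin

section \<open>Multi-matrix algebras\<close>

text \<open>
  A state over time function is a single function defined on all pairs of multi-matrix algebras,
  including algebras that are themselves tensor products.  The summands of a direct sum are
  therefore indexed by a type that is closed under pairing: the finite index sets are the finite
  sets of labels, and the product of two of them is again a set of labels.

  A multi-matrix algebra is given by its block sizes.  The index set of \<^term>\<open>m\<close> is
  \<open>{x. m x \<noteq> 0}\<close>, which must be finite; a block of size zero is the zero space, so a label outside
  of the index set contributes nothing.  In particular an element is determined by its components
  in the index set, because there is only one matrix of size \<open>0 \<times> 0\<close>.
\<close>

datatype 'a label = Atom 'a | Pair "'a label" "'a label"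

type_synonym 'a algebra = "'a label \<Rightarrow> nat"
type_synonym 'a elt = "'a label \<Rightarrow> complex mat"

definition multi_matrix :: "'a algebra \<Rightarrow> bool" where
  "multi_matrix A \<longleftrightarrow> finite {x. A x \<noteq> 0}"

definition elements :: "'a algebra \<Rightarrow> 'a elt set" where
  "elements A = {a. \<forall>x. a x \<in> carrier_mat (A x) (A x)}"

definition alg_add :: "'a elt \<Rightarrow> 'a elt \<Rightarrow> 'a elt" where
  "alg_add a b = (\<lambda>x. a x + b x)"

definition alg_diff :: "'a elt \<Rightarrow> 'a elt \<Rightarrow> 'a elt" where
  "alg_diff a b = (\<lambda>x. a x - b x)"

definition alg_smult :: "complex \<Rightarrow> 'a elt \<Rightarrow> 'a elt" where
  "alg_smult c a = (\<lambda>x. c \<cdot>\<^sub>m a x)"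

definition alg_mult :: "'a elt \<Rightarrow> 'a elt \<Rightarrow> 'a elt" where
  "alg_mult a b = (\<lambda>x. a x * b x)"

definition alg_adjoint :: "'a elt \<Rightarrow> 'a elt" where
  "alg_adjoint a = (\<lambda>x. mat_adjoint (a x))"

definition alg_zero :: "'a algebra \<Rightarrow> 'a elt" where
  "alg_zero A = (\<lambda>x. 0\<^sub>m (A x) (A x))"

definition alg_one :: "'a algebra \<Rightarrow> 'a elt" where
  "alg_one A = (\<lambda>x. 1\<^sub>m (A x))"

definition alg_sum :: "'a algebra \<Rightarrow> ('b \<Rightarrow> 'a elt) \<Rightarrow> 'b set \<Rightarrow> 'a elt" where
  "alg_sum A f I = (\<lambda>x. mat (A x) (A x) (\<lambda>p. \<Sum>i\<in>I. f i x $$ p))"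

definition alg_commutator :: "'a elt \<Rightarrow> 'a elt \<Rightarrow> 'a elt" where
  "alg_commutator a b = alg_diff (alg_mult a b) (alg_mult b a)"

definition mat_trace :: "complex mat \<Rightarrow> complex" where
  "mat_trace M = (\<Sum>i<dim_row M. M $$ (i, i))"

definition alg_trace :: "'a algebra \<Rightarrow> 'a elt \<Rightarrow> complex" where
  "alg_trace A a = (\<Sum>x | A x \<noteq> 0. mat_trace (a x))"

definition positive :: "'a algebra \<Rightarrow> 'a elt set" where
  "positive A = {a. \<exists>c\<in>elements A. a = alg_mult (alg_adjoint c) c}"

definition states :: "'a algebra \<Rightarrow> 'a elt set" where
  "states A = {a \<in> positive A. alg_trace A a = 1}"

text \<open>The algebras \<open>\<complex>\<^sup>X\<close> and the full matrix algebras (with single label \<^term>\<open>l\<close>).\<close>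

definition classical :: "'a label set \<Rightarrow> 'a algebra" where
  "classical X = (\<lambda>x. if x \<in> X then 1 else 0)"

definition delta :: "'a label set \<Rightarrow> 'a label \<Rightarrow> 'a elt" where
  "delta X x = (\<lambda>y. mat (classical X y) (classical X y) (\<lambda>_. if y = x then 1 else 0))"

definition full_matrix :: "'a label \<Rightarrow> nat \<Rightarrow> 'a algebra" where
  "full_matrix l n = (\<lambda>x. if x = l then n else 0)"


section \<open>Linear maps\<close>

text \<open>
  Maps are extensional, so that two maps which agree on their domain are equal.  The scalar
  twist \<^term>\<open>s\<close> is the identity for linear and \<^const>\<open>cnj\<close> for conjugate-linear maps.
\<close>

definition semilinear_maps ::
    "(complex \<Rightarrow> complex) \<Rightarrow> 'a algebra \<Rightarrow> 'a algebra \<Rightarrow> ('a elt \<Rightarrow> 'a elt) set" where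
  "semilinear_maps s A B = {\<Phi> \<in> elements A \<rightarrow>\<^sub>E elements B.
     (\<forall>a\<in>elements A. \<forall>b\<in>elements A. \<Phi> (alg_add a b) = alg_add (\<Phi> a) (\<Phi> b)) \<and>
     (\<forall>c. \<forall>a\<in>elements A. \<Phi> (alg_smult c a) = alg_smult (s c) (\<Phi> a))}"

abbreviation linear_maps :: "'a algebra \<Rightarrow> 'a algebra \<Rightarrow> ('a elt \<Rightarrow> 'a elt) set" where
  "linear_maps \<equiv> semilinear_maps (\<lambda>c. c)"

abbreviation antilinear_maps :: "'a algebra \<Rightarrow> 'a algebra \<Rightarrow> ('a elt \<Rightarrow> 'a elt) set" where
  "antilinear_maps \<equiv> semilinear_maps cnj"

definition identity_map :: "'a algebra \<Rightarrow> 'a elt \<Rightarrow> 'a elt" where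
  "identity_map A = restrict (\<lambda>a. a) (elements A)"

definition hs_adjoint ::
    "'a algebra \<Rightarrow> 'a algebra \<Rightarrow> ('a elt \<Rightarrow> 'a elt) \<Rightarrow> 'a elt \<Rightarrow> 'a elt" where
  "hs_adjoint A B \<Phi> = (THE \<Phi>'. \<Phi>' \<in> linear_maps B A \<and>
     (\<forall>a\<in>elements A. \<forall>b\<in>elements B.
        alg_trace B (alg_mult (alg_adjoint (\<Phi> a)) b) =
        alg_trace A (alg_mult (alg_adjoint a) (\<Phi>' b))))"


section \<open>Tensor products\<close>

definition tensor :: "'a algebra \<Rightarrow> 'a algebra \<Rightarrow> 'a algebra" where
  "tensor A B = (\<lambda>z. case z of Atom _ \<Rightarrow> 0 | Pair x y \<Rightarrow> A x * B y)"

definition kronecker :: "complex mat \<Rightarrow> complex mat \<Rightarrow> complex mat" where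
  "kronecker M N = mat (dim_row M * dim_row N) (dim_col M * dim_col N)
     (\<lambda>(i, j). M $$ (i div dim_row N, j div dim_col N) * N $$ (i mod dim_row N, j mod dim_col N))"

definition tensor_elt :: "'a elt \<Rightarrow> 'a elt \<Rightarrow> 'a elt" where
  "tensor_elt a b = (\<lambda>z. case z of Atom _ \<Rightarrow> 0\<^sub>m 0 0 | Pair x y \<Rightarrow> kronecker (a x) (b y))"

text \<open>The (conjugate-)linear map on \<open>A \<otimes> B\<close> that is determined by its values
  \<^term>\<open>f a b\<close> on the product elements \<open>a \<otimes> b\<close>.\<close>

definition tensor_extension ::
    "(complex \<Rightarrow> complex) \<Rightarrow> 'a algebra \<Rightarrow> 'a algebra \<Rightarrow> 'a algebra \<Rightarrow>
     ('a elt \<Rightarrow> 'a elt \<Rightarrow> 'a elt) \<Rightarrow> 'a elt \<Rightarrow> 'a elt" where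
  "tensor_extension s A B C f = (THE h. h \<in> semilinear_maps s (tensor A B) C \<and>
     (\<forall>a\<in>elements A. \<forall>b\<in>elements B. h (tensor_elt a b) = f a b))"

definition tensor_map ::
    "'a algebra \<Rightarrow> 'a algebra \<Rightarrow> 'a algebra \<Rightarrow> 'a algebra \<Rightarrow>
     ('a elt \<Rightarrow> 'a elt) \<Rightarrow> ('a elt \<Rightarrow> 'a elt) \<Rightarrow> 'a elt \<Rightarrow> 'a elt" where
  "tensor_map A B A' B' f g =
     tensor_extension (\<lambda>c. c) A B (tensor A' B') (\<lambda>a b. tensor_elt (f a) (g b))"

definition multiplication_map :: "'a algebra \<Rightarrow> 'a elt \<Rightarrow> 'a elt" where
  "multiplication_map A = tensor_extension (\<lambda>c. c) A A A alg_mult"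

text \<open>\<open>trace_left\<close> is \<open>tr\<^sub>A : A \<otimes> B \<rightarrow> B\<close> and \<open>trace_right\<close> is \<open>tr\<^sub>B : A \<otimes> B \<rightarrow> A\<close>.\<close>

definition trace_left :: "'a algebra \<Rightarrow> 'a algebra \<Rightarrow> 'a elt \<Rightarrow> 'a elt" where
  "trace_left A B = tensor_extension (\<lambda>c. c) A B B (\<lambda>a b. alg_smult (alg_trace A a) b)"

definition trace_right :: "'a algebra \<Rightarrow> 'a algebra \<Rightarrow> 'a elt \<Rightarrow> 'a elt" where
  "trace_right A B = tensor_extension (\<lambda>c. c) A B A (\<lambda>a b. alg_smult (alg_trace B b) a)"

definition time_reversal :: "'a algebra \<Rightarrow> 'a algebra \<Rightarrow> 'a elt \<Rightarrow> 'a elt" where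
  "time_reversal B A =
     tensor_extension cnj B A (tensor A B) (\<lambda>b a. tensor_elt (alg_adjoint a) (alg_adjoint b))"


section \<open>Channels, states over time and Bayesian inverses\<close>

definition completely_positive :: "'a algebra \<Rightarrow> 'a algebra \<Rightarrow> ('a elt \<Rightarrow> 'a elt) set" where
  "completely_positive A B = {\<Phi> \<in> linear_maps A B. \<forall>l n. n > 0 \<longrightarrow>
     (let M = full_matrix l n in
      \<forall>a\<in>positive (tensor M A). tensor_map M A M B (identity_map M) \<Phi> a \<in> positive (tensor M B))}"

definition CPTP :: "'a algebra \<Rightarrow> 'a algebra \<Rightarrow> ('a elt \<Rightarrow> 'a elt) set" where
  "CPTP A B = {\<Phi> \<in> completely_positive A B. \<forall>a\<in>elements A. alg_trace B (\<Phi> a) = alg_trace A a}"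

definition channel_state :: "'a algebra \<Rightarrow> 'a algebra \<Rightarrow> ('a elt \<Rightarrow> 'a elt) \<Rightarrow> 'a elt" where
  "channel_state A B \<Phi> = tensor_map A A A B (identity_map A) \<Phi>
     (hs_adjoint (tensor A A) A (multiplication_map A) (alg_one A))"

type_synonym 'a sot = "'a algebra \<Rightarrow> 'a algebra \<Rightarrow> ('a elt \<Rightarrow> 'a elt) \<Rightarrow> 'a elt \<Rightarrow> 'a elt"

definition state_over_time_function :: "'a sot \<Rightarrow> bool" where
  "state_over_time_function star \<longleftrightarrow>
     (\<forall>A B \<Phi> \<rho>. multi_matrix A \<longrightarrow> multi_matrix B \<longrightarrow> \<Phi> \<in> CPTP A B \<longrightarrow> \<rho> \<in> states A \<longrightarrow>
        star A B \<Phi> \<rho> \<in> elements (tensor A B) \<and>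
        trace_right A B (star A B \<Phi> \<rho>) = \<rho> \<and>
        trace_left A B (star A B \<Phi> \<rho>) = \<Phi> \<rho>)"

definition classical_limit :: "'a sot \<Rightarrow> bool" where
  "classical_limit star \<longleftrightarrow>
     (\<forall>A B \<Phi> \<rho>. multi_matrix A \<longrightarrow> multi_matrix B \<longrightarrow> \<Phi> \<in> CPTP A B \<longrightarrow> \<rho> \<in> states A \<longrightarrow>
        alg_commutator (channel_state A B \<Phi>) (tensor_elt \<rho> (alg_one B)) = alg_zero (tensor A B) \<longrightarrow>
        star A B \<Phi> \<rho> = alg_mult (channel_state A B \<Phi>) (tensor_elt \<rho> (alg_one B)))"

definition is_bayesian_inverse ::
    "'a sot \<Rightarrow> 'a algebra \<Rightarrow> 'a algebra \<Rightarrow> ('a elt \<Rightarrow> 'a elt) \<Rightarrow> 'a elt \<Rightarrow> ('a elt \<Rightarrow> 'a elt) \<Rightarrow> bool"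
  where
  "is_bayesian_inverse star A B \<Phi> \<rho> \<Phi>' \<longleftrightarrow>
     \<Phi>' \<in> CPTP B A \<and> star A B \<Phi> \<rho> = time_reversal B A (star B A \<Phi>' (\<Phi> \<rho>))"

definition bayesian_inverse ::
    "'a sot \<Rightarrow> 'a algebra \<Rightarrow> 'a algebra \<Rightarrow> ('a elt \<Rightarrow> 'a elt) \<Rightarrow> 'a elt \<Rightarrow> 'a elt \<Rightarrow> 'a elt" where
  "bayesian_inverse star A B \<Phi> \<rho> = (THE \<Phi>'. is_bayesian_inverse star A B \<Phi> \<rho> \<Phi>')"


section \<open>The definite descriptions are well defined\<close>

text \<open>
  The definitions of \<^const>\<open>hs_adjoint\<close> and \<^const>\<open>tensor_extension\<close> describe an object
  uniquely.  For maps built from \<^const>\<open>tensor_extension\<close> the existence of the described object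
  amounts to the bilinearity (for \<^const>\<open>time_reversal\<close>: conjugate-bilinearity) of the values
  on product elements.
\<close>

lemma elements_dims:
  assumes "a \<in> elements A" shows "dim_row (a x) = A x" "dim_col (a x) = A x"
  using assms by (auto simp: elements_def)

lemma alg_sum_empty [simp]: "alg_sum A f {} = alg_zero A"
  by (intro ext eq_matI) (auto simp: alg_sum_def alg_zero_def)

lemma alg_sum_insert:
  assumes "finite I" "i \<notin> I" "f i \<in> elements A"
  shows "alg_sum A f (insert i I) = alg_add (f i) (alg_sum A f I)"
proof
  fix x
  have "f i x \<in> carrier_mat (A x) (A x)" using assms(3) by (simp add: elements_def)
  then show "alg_sum A f (insert i I) x = alg_add (f i) (alg_sum A f I) x"
    using assms(1,2) by (intro eq_matI) (auto simp: alg_sum_def alg_add_def)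
qed

lemma alg_sum_in_elements [simp]: "alg_sum A f I \<in> elements A"
  by (simp add: elements_def alg_sum_def)

lemma alg_smult_in_elements [simp]: "a \<in> elements A \<Longrightarrow> alg_smult c a \<in> elements A"
  by (simp add: elements_def alg_smult_def)

lemma alg_sum_cong:
  "(\<And>i. i \<in> I \<Longrightarrow> f i = g i) \<Longrightarrow> alg_sum A f I = alg_sum A g I"
  by (auto simp: alg_sum_def intro!: ext eq_matI sum.cong)

lemma semilinear_zero:
  assumes "h \<in> semilinear_maps s A C" "s 0 = 0"
  shows "h (alg_zero A) = alg_zero C"
proof -
  have z: "alg_zero A \<in> elements A" by (simp add: alg_zero_def elements_def)
  then have hz: "h (alg_zero A) \<in> elements C" using assms by (auto simp: semilinear_maps_def)
  have "alg_smult 0 (alg_zero A) = alg_zero A"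
    by (auto simp: alg_smult_def alg_zero_def intro!: ext eq_matI)
  moreover have "h (alg_smult 0 (alg_zero A)) = alg_smult (s 0) (h (alg_zero A))"
    using assms(1) z by (simp add: semilinear_maps_def)
  ultimately have "h (alg_zero A) = alg_smult 0 (h (alg_zero A))"
    using assms(2) by simp
  also have "\<dots> = alg_zero C"
    by (intro ext eq_matI) (simp_all add: alg_smult_def alg_zero_def[of C] elements_dims[OF hz])
  finally show ?thesis .
qed

lemma semilinear_sum:
  assumes h: "h \<in> semilinear_maps s A C" and "s 0 = 0" and "finite I"
    and "\<And>i. i \<in> I \<Longrightarrow> f i \<in> elements A"
  shows "h (alg_sum A f I) = alg_sum C (\<lambda>i. h (f i)) I"
  using assms(3,4)
proof (induction I)
  case empty
  then show ?case using semilinear_zero[OF h] assms(2) by simp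
next
  case (insert i I)
  moreover have "h (f i) \<in> elements C" using h insert by (auto simp: semilinear_maps_def)
  ultimately show ?case using h by (simp add: alg_sum_insert semilinear_maps_def)
qed

definition unit_labels :: "'a algebra \<Rightarrow> ('a label \<times> nat \<times> nat) set" where
  "unit_labels A = (SIGMA x:{x. A x \<noteq> 0}. {..<A x} \<times> {..<A x})"

definition matrix_unit :: "'a algebra \<Rightarrow> 'a label \<times> nat \<times> nat \<Rightarrow> 'a elt" where
  "matrix_unit A p = (\<lambda>y. mat (A y) (A y) (\<lambda>(k, l). if (y, k, l) = p then 1 else 0))"

definition entry :: "'a elt \<Rightarrow> 'a label \<times> nat \<times> nat \<Rightarrow> complex" where
  "entry a p = (case p of (x, i, j) \<Rightarrow> a x $$ (i, j))"

lemma finite_unit_labels [simp]: "multi_matrix A \<Longrightarrow> finite (unit_labels A)"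
  by (auto simp: unit_labels_def multi_matrix_def)

lemma matrix_unit_in [simp]: "matrix_unit A p \<in> elements A"
  by (simp add: matrix_unit_def elements_def)

lemma elements_eqI:
  assumes "a \<in> elements A" "b \<in> elements A" "\<And>p. p \<in> unit_labels A \<Longrightarrow> entry a p = entry b p"
  shows "a = b"
proof
  fix x
  have c: "a x \<in> carrier_mat (A x) (A x)" "b x \<in> carrier_mat (A x) (A x)"
    using assms by (auto simp: elements_def)
  show "a x = b x"
  proof (rule eq_matI)
    fix i j assume "i < dim_row (b x)" "j < dim_col (b x)"
    then have "(x, i, j) \<in> unit_labels A" using c by (auto simp: unit_labels_def)
    from assms(3)[OF this] show "a x $$ (i, j) = b x $$ (i, j)" by (simp add: entry_def)
  qed (use c in auto)
qed

lemma entry_alg_sum: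
  "p \<in> unit_labels A \<Longrightarrow> entry (alg_sum A f I) p = (\<Sum>i\<in>I. entry (f i) p)"
  by (auto simp: entry_def alg_sum_def unit_labels_def)

lemma entry_alg_add:
  "p \<in> unit_labels A \<Longrightarrow> b \<in> elements A \<Longrightarrow> entry (alg_add a b) p = entry a p + entry b p"
  by (auto simp: entry_def alg_add_def unit_labels_def elements_dims)

lemma entry_alg_smult:
  "p \<in> unit_labels A \<Longrightarrow> a \<in> elements A \<Longrightarrow> entry (alg_smult c a) p = c * entry a p"
  by (auto simp: entry_def alg_smult_def unit_labels_def elements_dims)

lemma entry_matrix_unit:
  "p \<in> unit_labels A \<Longrightarrow> entry (matrix_unit A q) p = (if p = q then 1 else 0)"
  by (auto simp: entry_def matrix_unit_def unit_labels_def)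

lemma element_expand:
  assumes "multi_matrix A" "a \<in> elements A"
  shows "a = alg_sum A (\<lambda>p. alg_smult (entry a p) (matrix_unit A p)) (unit_labels A)"
  using assms
  by (intro elements_eqI[of _ A])
     (auto simp: entry_alg_sum entry_alg_smult entry_matrix_unit sum.delta if_distrib cong: if_cong)

lemma semilinear_expand:
  assumes "multi_matrix A" "a \<in> elements A" and h: "h \<in> semilinear_maps s A C" and "s 0 = 0"
  shows "h a = alg_sum C (\<lambda>p. alg_smult (s (entry a p)) (h (matrix_unit A p))) (unit_labels A)"
proof -
  have "h a = h (alg_sum A (\<lambda>p. alg_smult (entry a p) (matrix_unit A p)) (unit_labels A))"
    using element_expand[OF assms(1,2)] by simp
  also have "\<dots> = alg_sum C (\<lambda>p. h (alg_smult (entry a p) (matrix_unit A p))) (unit_labels A)"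
    using assms by (intro semilinear_sum[OF h]) auto
  also have "\<dots> = alg_sum C (\<lambda>p. alg_smult (s (entry a p)) (h (matrix_unit A p))) (unit_labels A)"
    using h by (intro alg_sum_cong) (auto simp: semilinear_maps_def)
  finally show ?thesis .
qed

lemma multi_matrix_tensor:
  assumes "multi_matrix A" "multi_matrix B" shows "multi_matrix (tensor A B)"
proof -
  have "{z. tensor A B z \<noteq> 0} \<subseteq> (\<lambda>(x, y). Pair x y) ` ({x. A x \<noteq> 0} \<times> {y. B y \<noteq> 0})"
  proof
    fix z assume "z \<in> {z. tensor A B z \<noteq> 0}"
    then show "z \<in> (\<lambda>(x, y). Pair x y) ` ({x. A x \<noteq> 0} \<times> {y. B y \<noteq> 0})"
      by (cases z) (auto simp: tensor_def)
  qed
  moreover have "finite \<dots>" using assms by (auto simp: multi_matrix_def)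
  ultimately show ?thesis unfolding multi_matrix_def by (rule finite_subset)
qed

lemma tensor_elt_in: "a \<in> elements A \<Longrightarrow> b \<in> elements B \<Longrightarrow> tensor_elt a b \<in> elements (tensor A B)"
  unfolding elements_def[of "tensor A B"]
  by (auto simp: tensor_def tensor_elt_def kronecker_def elements_dims split: label.splits)

definition pair_label where
  "pair_label B p q = (case (p, q) of ((x, i, j), (y, k, l)) \<Rightarrow>
     (Pair x y, i * B y + k, j * B y + l))"

lemma mult_add_less_mult: "i < (m::nat) \<Longrightarrow> k < n \<Longrightarrow> i * n + k < m * n"
  using mult_le_mono1[of "Suc i" m n] by simp

lemma pair_label_bij:
  "bij_betw (\<lambda>(p, q). pair_label B p q) (unit_labels A \<times> unit_labels B) (unit_labels (tensor A B))"
  unfolding bij_betw_def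
proof
  show "inj_on (\<lambda>(p, q). pair_label B p q) (unit_labels A \<times> unit_labels B)"
  proof (rule inj_onI)
    fix u v assume uv: "u \<in> unit_labels A \<times> unit_labels B" "v \<in> unit_labels A \<times> unit_labels B"
      "(\<lambda>(p, q). pair_label B p q) u = (\<lambda>(p, q). pair_label B p q) v"
    obtain x i j y k l x' i' j' y' k' l' where
      [simp]: "u = ((x, i, j), (y, k, l))" "v = ((x', i', j'), (y', k', l'))"
      by (metis surj_pair)
    have *: "(x, i, j) \<in> unit_labels A" "(y, k, l) \<in> unit_labels B"
       "(x', i', j') \<in> unit_labels A" "(y', k', l') \<in> unit_labels B"
       "pair_label B (x, i, j) (y, k, l) = pair_label B (x', i', j') (y', k', l')"
      using uv by auto
    then have [simp]: "x' = x" "y' = y" by (auto simp: pair_label_def)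
    have b: "k < B y" "l < B y" "k' < B y" "l' < B y" using * by (auto simp: unit_labels_def)
    have e: "i * B y + k = i' * B y + k'" "j * B y + l = j' * B y + l'"
      using * by (auto simp: pair_label_def)
    have "i = i'" using arg_cong[OF e(1), of "\<lambda>n. n div B y"] b by simp
    moreover have "k = k'" using arg_cong[OF e(1), of "\<lambda>n. n mod B y"] b by simp
    moreover have "j = j'" using arg_cong[OF e(2), of "\<lambda>n. n div B y"] b by simp
    moreover have "l = l'" using arg_cong[OF e(2), of "\<lambda>n. n mod B y"] b by simp
    ultimately show "u = v" by simp
  qed
  show "(\<lambda>(p, q). pair_label B p q) ` (unit_labels A \<times> unit_labels B) = unit_labels (tensor A B)"
  proof (intro equalityI subsetI)
    fix r assume "r \<in> (\<lambda>(p, q). pair_label B p q) ` (unit_labels A \<times> unit_labels B)"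
    then show "r \<in> unit_labels (tensor A B)"
      by (auto simp: unit_labels_def pair_label_def tensor_def mult_add_less_mult)
  next
    fix r assume r: "r \<in> unit_labels (tensor A B)"
    then obtain x y i j where [simp]: "r = (Pair x y, i, j)" and ij: "i < A x * B y" "j < A x * B y"
      by (auto simp: unit_labels_def tensor_def split: label.splits)
    then have "B y > 0" "A x > 0" by (auto intro!: Nat.gr0I)
    moreover from ij have "i div B y < A x" "j div B y < A x" by (auto simp: less_mult_imp_div_less)
    ultimately have "((x, i div B y, j div B y), (y, i mod B y, j mod B y)) \<in> unit_labels A \<times> unit_labels B"
      by (auto simp: unit_labels_def)
    moreover have "r = pair_label B (x, i div B y, j div B y) (y, i mod B y, j mod B y)"
      by (simp add: pair_label_def)
    ultimately show "r \<in> (\<lambda>(p, q). pair_label B p q) ` (unit_labels A \<times> unit_labels B)"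
      by (metis (no_types, lifting) case_prod_conv image_eqI)
  qed
qed

lemma entry_tensor:
  assumes "p \<in> unit_labels A" "q \<in> unit_labels B" "a \<in> elements A" "b \<in> elements B"
  shows "entry (tensor_elt a b) (pair_label B p q) = entry a p * entry b q"
proof -
  obtain x i j y k l where [simp]: "p = (x, i, j)" "q = (y, k, l)" by (cases p, cases q)
  have b: "i < A x" "j < A x" "k < B y" "l < B y" using assms by (auto simp: unit_labels_def)
  have d: "dim_row (a x) = A x" "dim_col (a x) = A x" "dim_row (b y) = B y" "dim_col (b y) = B y"
    using assms by (auto simp: elements_def)
  show ?thesis using b by (simp add: entry_def pair_label_def tensor_elt_def kronecker_def d mult_add_less_mult)
qed

lemma matrix_unit_tensor:
  assumes "p \<in> unit_labels A" "q \<in> unit_labels B"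
  shows "matrix_unit (tensor A B) (pair_label B p q) = tensor_elt (matrix_unit A p) (matrix_unit B q)"
proof (rule elements_eqI[of _ "tensor A B"])
  fix r assume r: "r \<in> unit_labels (tensor A B)"
  then obtain p' q' where pq: "p' \<in> unit_labels A" "q' \<in> unit_labels B" "r = pair_label B p' q'"
    using pair_label_bij[of B A] by (force simp: bij_betw_def)
  have "r = pair_label B p q \<longleftrightarrow> p' = p \<and> q' = q"
    using pair_label_bij[of B A] assms pq by (force simp: bij_betw_def inj_on_def)
  then show "entry (matrix_unit (tensor A B) (pair_label B p q)) r =
      entry (tensor_elt (matrix_unit A p) (matrix_unit B q)) r"
    using r pq by (simp add: entry_matrix_unit entry_tensor)
qed (auto intro: tensor_elt_in)

theorem tensor_extension_ex1:
  assumes A: "multi_matrix A" and B: "multi_matrix B"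
    and s: "s = (\<lambda>c. c) \<or> s = cnj"
    and f1: "\<And>b. b \<in> elements B \<Longrightarrow> restrict (\<lambda>a. f a b) (elements A) \<in> semilinear_maps s A C"
    and f2: "\<And>a. a \<in> elements A \<Longrightarrow> restrict (f a) (elements B) \<in> semilinear_maps s B C"
  shows "\<exists>!h. h \<in> semilinear_maps s (tensor A B) C \<and>
     (\<forall>a\<in>elements A. \<forall>b\<in>elements B. h (tensor_elt a b) = f a b)"
proof -
  let ?T = "tensor A B"
  let ?U = "unit_labels A \<times> unit_labels B"
  have s0: "s 0 = 0" and sm: "\<And>c d. s (c * d) = s c * s d" and sa: "\<And>c d. s (c + d) = s c + s d"
    using s by auto
  have fin: "f a b \<in> elements C" if "a \<in> elements A" "b \<in> elements B" for a b
    using f1[OF that(2)] that by (auto simp: semilinear_maps_def)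
  define h where "h = restrict (\<lambda>z. alg_sum C (\<lambda>(p, q).
     alg_smult (s (entry z (pair_label B p q))) (f (matrix_unit A p) (matrix_unit B q))) ?U) (elements ?T)"
  have entry_h: "entry (h z) c =
     (\<Sum>(p, q)\<in>?U. s (entry z (pair_label B p q)) * entry (f (matrix_unit A p) (matrix_unit B q)) c)"
    if "z \<in> elements ?T" "c \<in> unit_labels C" for z c
    using that by (auto simp: h_def entry_alg_sum intro!: sum.cong)
      (simp add: entry_alg_smult[where A=C] fin)
  have lab: "pair_label B p q \<in> unit_labels ?T" if "p \<in> unit_labels A" "q \<in> unit_labels B" for p q
    using pair_label_bij[of B A] that by (force simp: bij_betw_def)
  have hin: "h z \<in> elements C" if "z \<in> elements ?T" for z using that by (simp add: h_def)
  have h: "h \<in> semilinear_maps s ?T C"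
    unfolding semilinear_maps_def
  proof (intro CollectI conjI ballI allI)
    show "h \<in> elements ?T \<rightarrow>\<^sub>E elements C" by (auto simp: h_def)
    fix a b assume ab: "a \<in> elements ?T" "b \<in> elements ?T"
    then have [simp]: "alg_add a b \<in> elements ?T" by (auto simp: elements_def alg_add_def)
    have [simp]: "alg_add (h a) (h b) \<in> elements C"
      using hin[OF ab(1)] hin[OF ab(2)] by (auto simp: elements_def alg_add_def)
    show "h (alg_add a b) = alg_add (h a) (h b)"
    proof (rule elements_eqI[of _ C])
      fix c assume c: "c \<in> unit_labels C"
      show "entry (h (alg_add a b)) c = entry (alg_add (h a) (h b)) c"
        unfolding entry_alg_add[OF c hin[OF ab(2)]] entry_h[OF ab(1) c] entry_h[OF ab(2) c]
          entry_h[OF \<open>alg_add a b \<in> _\<close> c] sum.distrib[symmetric]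
        by (rule sum.cong) (auto simp: entry_alg_add[OF lab ab(2)] sa distrib_right)
    qed (simp_all add: hin)
  next
    fix c a assume a: "a \<in> elements ?T"
    show "h (alg_smult c a) = alg_smult (s c) (h a)"
    proof (rule elements_eqI[of _ C])
      fix d assume d: "d \<in> unit_labels C"
      show "entry (h (alg_smult c a)) d = entry (alg_smult (s c) (h a)) d"
        unfolding entry_alg_smult[OF d hin[OF a]] entry_h[OF a d]
          entry_h[OF alg_smult_in_elements[OF a] d] sum_distrib_left
        by (rule sum.cong) (auto simp: entry_alg_smult[OF lab a] sm)
    qed (simp_all add: hin a)
  qed
  have val: "h (tensor_elt a b) = f a b" if ab: "a \<in> elements A" "b \<in> elements B" for a b
  proof (rule elements_eqI[of _ C])
    fix c assume c: "c \<in> unit_labels C"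
    have 1: "f a b = alg_sum C (\<lambda>p. alg_smult (s (entry a p)) (f (matrix_unit A p) b)) (unit_labels A)"
      using semilinear_expand[OF A ab(1) f1[OF ab(2)] s0] ab by simp
    have 2: "f (matrix_unit A p) b = alg_sum C (\<lambda>q. alg_smult (s (entry b q))
        (f (matrix_unit A p) (matrix_unit B q))) (unit_labels B)" for p
      using semilinear_expand[OF B ab(2) f2[OF matrix_unit_in] s0] ab by simp
    have "entry (f a b) c = (\<Sum>p\<in>unit_labels A. s (entry a p) * entry (f (matrix_unit A p) b) c)"
      by (subst 1) (simp add: entry_alg_sum entry_alg_smult[where A=C] c fin ab)
    also have "\<dots> = (\<Sum>p\<in>unit_labels A. \<Sum>q\<in>unit_labels B. s (entry a p) * (s (entry b q) *
        entry (f (matrix_unit A p) (matrix_unit B q)) c))"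
      unfolding 2 by (simp add: entry_alg_sum entry_alg_smult[where A=C] c fin sum_distrib_left)
    also have "\<dots> = entry (h (tensor_elt a b)) c"
      unfolding entry_h[OF tensor_elt_in[OF ab] c] sum.cartesian_product
      by (rule sum.cong) (auto simp: entry_tensor[OF _ _ ab] sm)
    finally show "entry (h (tensor_elt a b)) c = entry (f a b) c" ..
  qed (use ab in \<open>auto intro!: hin fin tensor_elt_in\<close>)
  show ?thesis
  proof (rule ex1I[of _ h])
    show "h \<in> semilinear_maps s ?T C \<and> (\<forall>a\<in>elements A. \<forall>b\<in>elements B. h (tensor_elt a b) = f a b)"
      using h val by blast
  next
    fix g assume g: "g \<in> semilinear_maps s ?T C \<and> (\<forall>a\<in>elements A. \<forall>b\<in>elements B. g (tensor_elt a b) = f a b)"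
    have u: "g (matrix_unit ?T r) = h (matrix_unit ?T r)" if r: "r \<in> unit_labels ?T" for r
    proof -
      obtain p q where pq: "p \<in> unit_labels A" "q \<in> unit_labels B" "r = pair_label B p q"
        using r pair_label_bij[of B A] by (force simp: bij_betw_def)
      then show ?thesis using g val by (simp add: matrix_unit_tensor)
    qed
    have "g z = h z" if z: "z \<in> elements ?T" for z
      unfolding semilinear_expand[OF multi_matrix_tensor[OF A B] z h s0]
        semilinear_expand[OF multi_matrix_tensor[OF A B] z conjunct1[OF g] s0]
      by (rule alg_sum_cong) (simp add: u)
    then show "g = h" using g h
      by (intro extensionalityI[of _ "elements ?T"]) (auto simp: semilinear_maps_def PiE_def)
  qed
qed

lemma tensor_extension:
  assumes "multi_matrix A" "multi_matrix B" "s = (\<lambda>c. c) \<or> s = cnj"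
    and "\<And>b. b \<in> elements B \<Longrightarrow> restrict (\<lambda>a. f a b) (elements A) \<in> semilinear_maps s A C"
    and "\<And>a. a \<in> elements A \<Longrightarrow> restrict (f a) (elements B) \<in> semilinear_maps s B C"
  shows "tensor_extension s A B C f \<in> semilinear_maps s (tensor A B) C"
    and "a \<in> elements A \<Longrightarrow> b \<in> elements B \<Longrightarrow> tensor_extension s A B C f (tensor_elt a b) = f a b"
  using theI'[OF tensor_extension_ex1[OF assms]] unfolding tensor_extension_def by blast+

lemma elementsI:
  "(\<And>x. dim_row (a x) = A x) \<Longrightarrow> (\<And>x. dim_col (a x) = A x) \<Longrightarrow> a \<in> elements A"
  by (auto simp: elements_def intro!: carrier_matI)

lemma alg_add_in_elements: "a \<in> elements A \<Longrightarrow> b \<in> elements A \<Longrightarrow> alg_add a b \<in> elements A"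
  by (auto simp: elements_def alg_add_def)

lemma alg_mult_in_elements: "a \<in> elements A \<Longrightarrow> b \<in> elements A \<Longrightarrow> alg_mult a b \<in> elements A"
  by (rule elementsI) (simp_all add: alg_mult_def elements_dims)

lemma mat_adjoint_index: "i < dim_col M \<Longrightarrow> j < dim_row M \<Longrightarrow> mat_adjoint M $$ (i, j) = cnj (M $$ (j, i))"
  for M :: "complex mat"
  by (simp add: mat_adjoint_def mat_of_rows_def)

lemma mat_adjoint_dims [simp]:
  "dim_row (mat_adjoint M) = dim_col M" "dim_col (mat_adjoint M) = dim_row M" for M :: "complex mat"
  by (simp_all add: mat_adjoint_def)

lemma alg_adjoint_in_elements: "a \<in> elements A \<Longrightarrow> alg_adjoint a \<in> elements A"
  by (rule elementsI) (simp_all add: alg_adjoint_def elements_dims)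

lemma hs_inner:
  assumes "multi_matrix A" "a \<in> elements A" "b \<in> elements A"
  shows "alg_trace A (alg_mult (alg_adjoint a) b) = (\<Sum>p\<in>unit_labels A. cnj (entry a p) * entry b p)"
proof -
  have fin: "finite {x. A x \<noteq> 0}" using assms by (simp add: multi_matrix_def)
  have "alg_trace A (alg_mult (alg_adjoint a) b) =
      (\<Sum>x | A x \<noteq> 0. \<Sum>j<A x. \<Sum>i<A x. cnj (a x $$ (i, j)) * b x $$ (i, j))"
    using elements_dims[OF assms(2)] elements_dims[OF assms(3)]
    by (auto simp: alg_trace_def mat_trace_def alg_mult_def alg_adjoint_def scalar_prod_def
        mat_adjoint_index lessThan_atLeast0 intro!: sum.cong)
  also have "\<dots> = (\<Sum>x | A x \<noteq> 0. \<Sum>i<A x. \<Sum>j<A x. cnj (a x $$ (i, j)) * b x $$ (i, j))"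
    by (intro sum.cong refl sum.swap)
  also have "\<dots> = (\<Sum>x | A x \<noteq> 0. \<Sum>r\<in>{..<A x} \<times> {..<A x}. cnj (entry a (x, r)) * entry b (x, r))"
    by (simp add: sum.cartesian_product entry_def case_prod_beta)
  also have "\<dots> = (\<Sum>p\<in>unit_labels A. cnj (entry a p) * entry b p)"
    unfolding unit_labels_def by (subst sum.Sigma[OF fin]) (simp_all add: split_beta)
  finally show ?thesis .
qed

theorem hs_adjoint_ex1:
  assumes A: "multi_matrix A" and B: "multi_matrix B" and \<Phi>: "\<Phi> \<in> linear_maps A B"
  shows "\<exists>!\<Phi>'. \<Phi>' \<in> linear_maps B A \<and>
     (\<forall>a\<in>elements A. \<forall>b\<in>elements B.
        alg_trace B (alg_mult (alg_adjoint (\<Phi> a)) b) =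
        alg_trace A (alg_mult (alg_adjoint a) (\<Phi>' b)))"
proof -
  have \<Phi>in: "\<Phi> a \<in> elements B" if "a \<in> elements A" for a
    using \<Phi> that by (auto simp: semilinear_maps_def)
  let ?t = "\<lambda>b p. \<Sum>q\<in>unit_labels B. cnj (entry (\<Phi> (matrix_unit A p)) q) * entry b q"
  define h where "h = restrict (\<lambda>b. alg_sum A (\<lambda>p. alg_smult (?t b p) (matrix_unit A p))
      (unit_labels A)) (elements B)"
  have hin: "h b \<in> elements A" if "b \<in> elements B" for b using that by (simp add: h_def)
  have entry_h: "entry (h b) p = ?t b p" if "b \<in> elements B" "p \<in> unit_labels A" for b p
    using that A by (simp add: h_def entry_alg_sum entry_alg_smult entry_matrix_unit
        if_distrib[of "\<lambda>c. _ * c"] sum.delta cong: if_cong)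
  have h: "h \<in> linear_maps B A"
    unfolding semilinear_maps_def
  proof (intro CollectI conjI ballI allI)
    show "h \<in> elements B \<rightarrow>\<^sub>E elements A" by (auto simp: h_def)
    fix a b assume ab: "a \<in> elements B" "b \<in> elements B"
    note ab' = alg_add_in_elements[OF ab]
    show "h (alg_add a b) = alg_add (h a) (h b)"
    proof (rule elements_eqI[of _ A])
      fix c assume c: "c \<in> unit_labels A"
      show "entry (h (alg_add a b)) c = entry (alg_add (h a) (h b)) c"
        unfolding entry_alg_add[OF c hin[OF ab(2)]] entry_h[OF ab(1) c] entry_h[OF ab(2) c]
          entry_h[OF ab' c] sum.distrib[symmetric]
        by (rule sum.cong) (auto simp: entry_alg_add[OF _ ab(2)] distrib_left)
    qed (simp_all add: hin ab ab' alg_add_in_elements)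
  next
    fix c a assume a: "a \<in> elements B"
    show "h (alg_smult c a) = alg_smult c (h a)"
    proof (rule elements_eqI[of _ A])
      fix d assume d: "d \<in> unit_labels A"
      show "entry (h (alg_smult c a)) d = entry (alg_smult c (h a)) d"
        unfolding entry_alg_smult[OF d hin[OF a]] entry_h[OF a d]
          entry_h[OF alg_smult_in_elements[OF a] d] sum_distrib_left
        by (rule sum.cong) (auto simp: entry_alg_smult[OF _ a])
    qed (simp_all add: hin a)
  qed
  have adj: "alg_trace B (alg_mult (alg_adjoint (\<Phi> a)) b) =
        alg_trace A (alg_mult (alg_adjoint a) (h b))"
    if ab: "a \<in> elements A" "b \<in> elements B" for a b
  proof -
    have "entry (\<Phi> a) q = (\<Sum>p\<in>unit_labels A. entry a p * entry (\<Phi> (matrix_unit A p)) q)"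
      if q: "q \<in> unit_labels B" for q
      by (subst semilinear_expand[OF A ab(1) \<Phi>])
         (simp_all add: entry_alg_sum[OF q] entry_alg_smult[OF q] \<Phi>in)
    then have "(\<Sum>q\<in>unit_labels B. cnj (entry (\<Phi> a) q) * entry b q) =
        (\<Sum>q\<in>unit_labels B. \<Sum>p\<in>unit_labels A.
           cnj (entry a p) * (cnj (entry (\<Phi> (matrix_unit A p)) q) * entry b q))"
      by (intro sum.cong refl) (simp add: sum_distrib_right mult.assoc)
    also have "\<dots> = (\<Sum>p\<in>unit_labels A. cnj (entry a p) * ?t b p)"
      unfolding sum_distrib_left by (rule sum.swap)
    finally show ?thesis
      using ab by (simp add: hs_inner A B \<Phi>in hin entry_h)
  qed
  show ?thesis
  proof (rule ex1I[of _ h])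
    fix g assume g: "g \<in> linear_maps B A \<and> (\<forall>a\<in>elements A. \<forall>b\<in>elements B.
      alg_trace B (alg_mult (alg_adjoint (\<Phi> a)) b) = alg_trace A (alg_mult (alg_adjoint a) (g b)))"
    have gin: "g b \<in> elements A" if "b \<in> elements B" for b
      using g that by (auto simp: semilinear_maps_def)
    have un: "(\<Sum>p\<in>unit_labels A. cnj (entry (matrix_unit A r) p) * entry c p) = entry c r"
      if "r \<in> unit_labels A" for r c
    proof -
      have "(\<Sum>p\<in>unit_labels A. cnj (entry (matrix_unit A r) p) * entry c p) =
          (\<Sum>p\<in>unit_labels A. if p = r then entry c p else 0)"
        by (rule sum.cong) (auto simp: entry_matrix_unit)
      then show ?thesis using that A by (simp add: sum.delta)
    qed
    have "g b = h b" if b: "b \<in> elements B" for b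
    proof (rule elements_eqI[OF gin[OF b] hin[OF b]])
      fix r assume r: "r \<in> unit_labels A"
      have "alg_trace A (alg_mult (alg_adjoint (matrix_unit A r)) (g b)) =
            alg_trace A (alg_mult (alg_adjoint (matrix_unit A r)) (h b))"
        using g adj[OF matrix_unit_in b] b by (metis matrix_unit_in)
      then show "entry (g b) r = entry (h b) r"
        by (simp add: hs_inner A gin hin b un r)
    qed
    then show "g = h" using g h
      by (intro extensionalityI[of _ "elements B"]) (auto simp: semilinear_maps_def PiE_def)
  qed (use h adj in blast)
qed

lemma hs_adjoint:
  assumes "multi_matrix A" "multi_matrix B" "\<Phi> \<in> linear_maps A B"
  shows "hs_adjoint A B \<Phi> \<in> linear_maps B A"
    and "a \<in> elements A \<Longrightarrow> b \<in> elements B \<Longrightarrow>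
      alg_trace B (alg_mult (alg_adjoint (\<Phi> a)) b) = alg_trace A (alg_mult (alg_adjoint a) (hs_adjoint A B \<Phi> b))"
  using theI'[OF hs_adjoint_ex1[OF assms], folded hs_adjoint_def] by simp_all

lemma tensor_extensionI:
  assumes "multi_matrix A" "multi_matrix B" "s = (\<lambda>c. c) \<or> s = cnj"
    and "\<And>a b. a \<in> elements A \<Longrightarrow> b \<in> elements B \<Longrightarrow> f a b \<in> elements C"
    and "\<And>a a' b. a \<in> elements A \<Longrightarrow> a' \<in> elements A \<Longrightarrow> b \<in> elements B \<Longrightarrow>
           f (alg_add a a') b = alg_add (f a b) (f a' b)"
    and "\<And>a b b'. a \<in> elements A \<Longrightarrow> b \<in> elements B \<Longrightarrow> b' \<in> elements B \<Longrightarrow>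
           f a (alg_add b b') = alg_add (f a b) (f a b')"
    and "\<And>c a b. a \<in> elements A \<Longrightarrow> b \<in> elements B \<Longrightarrow> f (alg_smult c a) b = alg_smult (s c) (f a b)"
    and "\<And>c a b. a \<in> elements A \<Longrightarrow> b \<in> elements B \<Longrightarrow> f a (alg_smult c b) = alg_smult (s c) (f a b)"
  shows "tensor_extension s A B C f \<in> semilinear_maps s (tensor A B) C \<and>
    (\<forall>a\<in>elements A. \<forall>b\<in>elements B. tensor_extension s A B C f (tensor_elt a b) = f a b)"
proof -
  have 1: "restrict (\<lambda>a. f a b) (elements A) \<in> semilinear_maps s A C" if "b \<in> elements B" for b
    using assms that by (auto simp: semilinear_maps_def alg_add_in_elements)
  have 2: "restrict (f a) (elements B) \<in> semilinear_maps s B C" if "a \<in> elements A" for a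
    using assms that by (auto simp: semilinear_maps_def alg_add_in_elements)
  show ?thesis
    using tensor_extension[OF assms(1-3) 1 2] by blast
qed

lemma alg_mult_add_left:
  "a \<in> elements A \<Longrightarrow> b \<in> elements A \<Longrightarrow> d \<in> elements A \<Longrightarrow>
   alg_mult (alg_add a b) d = alg_add (alg_mult a d) (alg_mult b d)"
  unfolding elements_def alg_mult_def alg_add_def
  by (rule ext, rule add_mult_distrib_mat) fast+

lemma alg_mult_add_right:
  "a \<in> elements A \<Longrightarrow> b \<in> elements A \<Longrightarrow> d \<in> elements A \<Longrightarrow>
   alg_mult d (alg_add a b) = alg_add (alg_mult d a) (alg_mult d b)"
  unfolding elements_def alg_mult_def alg_add_def
  by (rule ext, rule mult_add_distrib_mat) fast+

lemma alg_mult_smult_left: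
  "a \<in> elements A \<Longrightarrow> d \<in> elements A \<Longrightarrow> alg_mult (alg_smult c a) d = alg_smult c (alg_mult a d)"
  unfolding elements_def alg_mult_def alg_smult_def
  by (rule ext, rule mult_smult_assoc_mat) fast+

lemma alg_mult_smult_right:
  "a \<in> elements A \<Longrightarrow> d \<in> elements A \<Longrightarrow> alg_mult d (alg_smult c a) = alg_smult c (alg_mult d a)"
  unfolding elements_def alg_mult_def alg_smult_def
  by (rule ext, rule mult_smult_distrib) fast+

lemma alg_trace_add:
  "a \<in> elements A \<Longrightarrow> b \<in> elements A \<Longrightarrow> alg_trace A (alg_add a b) = alg_trace A a + alg_trace A b"
  using elements_dims[of a A] elements_dims[of b A]
  by (simp add: alg_trace_def mat_trace_def alg_add_def sum.distrib)

lemma alg_trace_smult: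
  "a \<in> elements A \<Longrightarrow> alg_trace A (alg_smult c a) = c * alg_trace A a"
  using elements_dims[of a A]
  by (simp add: alg_trace_def mat_trace_def alg_smult_def sum_distrib_left)

lemma div_mod_less:
  assumes "i < m * (n::nat)" shows "i div n < m" "i mod n < n"
proof -
  have "n > 0" using assms by (intro Nat.gr0I) auto
  then show "i div n < m" "i mod n < n" using assms by (auto simp: less_mult_imp_div_less)
qed

lemma tensor_elt_add_left:
  assumes "a \<in> elements A" "a' \<in> elements A" "b \<in> elements B"
  shows "tensor_elt (alg_add a a') b = alg_add (tensor_elt a b) (tensor_elt a' b)"
  using elements_dims[OF assms(1)] elements_dims[OF assms(2)] elements_dims[OF assms(3)]
  by (auto simp: tensor_elt_def alg_add_def kronecker_def distrib_left distrib_right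
      div_mod_less split: label.splits intro!: ext eq_matI)

lemma tensor_elt_add_right:
  assumes "a \<in> elements A" "b \<in> elements B" "b' \<in> elements B"
  shows "tensor_elt a (alg_add b b') = alg_add (tensor_elt a b) (tensor_elt a b')"
  using elements_dims[OF assms(1)] elements_dims[OF assms(2)] elements_dims[OF assms(3)]
  by (auto simp: tensor_elt_def alg_add_def kronecker_def distrib_left distrib_right
      div_mod_less split: label.splits intro!: ext eq_matI)

lemma tensor_elt_smult_left: "tensor_elt (alg_smult c a) b = alg_smult c (tensor_elt a b)"
  by (auto simp: tensor_elt_def alg_smult_def kronecker_def div_mod_less
      split: label.splits intro!: ext eq_matI)

lemma tensor_elt_smult_right: "tensor_elt a (alg_smult c b) = alg_smult c (tensor_elt a b)"
  by (auto simp: tensor_elt_def alg_smult_def kronecker_def div_mod_less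
      split: label.splits intro!: ext eq_matI)

lemma alg_adjoint_add:
  "a \<in> elements A \<Longrightarrow> b \<in> elements A \<Longrightarrow>
   alg_adjoint (alg_add a b) = alg_add (alg_adjoint a) (alg_adjoint b)"
  using elements_dims[of a A] elements_dims[of b A]
  by (auto simp: alg_adjoint_def alg_add_def mat_adjoint_index intro!: ext eq_matI)

lemma alg_adjoint_smult: "alg_adjoint (alg_smult c a) = alg_smult (cnj c) (alg_adjoint a)"
  by (auto simp: alg_adjoint_def alg_smult_def mat_adjoint_index intro!: ext eq_matI)

lemma alg_smult_add_left: "alg_smult (c + d) a = alg_add (alg_smult c a) (alg_smult d a)"
  by (auto simp: alg_smult_def alg_add_def distrib_right intro!: ext eq_matI)

lemma alg_smult_add_right:
  "a \<in> elements A \<Longrightarrow> b \<in> elements A \<Longrightarrow> alg_smult c (alg_add a b) = alg_add (alg_smult c a) (alg_smult c b)"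
  using elements_dims[of a A] elements_dims[of b A]
  by (auto simp: alg_smult_def alg_add_def distrib_left intro!: ext eq_matI)

lemma alg_smult_smult: "alg_smult c (alg_smult d a) = alg_smult (c * d) a"
  by (auto simp: alg_smult_def mult.assoc intro!: ext eq_matI)

lemma multiplication_map:
  assumes "multi_matrix A"
  shows "multiplication_map A \<in> linear_maps (tensor A A) A \<and>
    (\<forall>a\<in>elements A. \<forall>b\<in>elements A. multiplication_map A (tensor_elt a b) = alg_mult a b)"
  unfolding multiplication_map_def using assms
  by (intro tensor_extensionI) (simp_all add: alg_mult_in_elements alg_mult_smult_left[of _ A]
      alg_mult_smult_right[of _ A] alg_mult_add_left[of _ A] alg_mult_add_right[of _ A])

lemma trace_left:
  assumes "multi_matrix A" "multi_matrix B"
  shows "trace_left A B \<in> linear_maps (tensor A B) B \<and>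
    (\<forall>a\<in>elements A. \<forall>b\<in>elements B. trace_left A B (tensor_elt a b) = alg_smult (alg_trace A a) b)"
  unfolding trace_left_def using assms
  by (intro tensor_extensionI) (simp_all add: alg_trace_add alg_trace_smult alg_smult_smult
      alg_smult_add_left alg_smult_add_right[of _ B] mult.commute)

lemma trace_right:
  assumes "multi_matrix A" "multi_matrix B"
  shows "trace_right A B \<in> linear_maps (tensor A B) A \<and>
    (\<forall>a\<in>elements A. \<forall>b\<in>elements B. trace_right A B (tensor_elt a b) = alg_smult (alg_trace B b) a)"
  unfolding trace_right_def using assms
  by (intro tensor_extensionI) (simp_all add: alg_trace_add alg_trace_smult alg_smult_smult
      alg_smult_add_left alg_smult_add_right[of _ A] mult.commute)

lemma time_reversal:
  assumes "multi_matrix A" "multi_matrix B"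
  shows "time_reversal B A \<in> antilinear_maps (tensor B A) (tensor A B) \<and>
    (\<forall>b\<in>elements B. \<forall>a\<in>elements A.
      time_reversal B A (tensor_elt b a) = tensor_elt (alg_adjoint a) (alg_adjoint b))"
  unfolding time_reversal_def using assms
  by (intro tensor_extensionI) (simp_all add: tensor_elt_in alg_adjoint_in_elements
      alg_adjoint_add[of _ A] alg_adjoint_add[of _ B] alg_adjoint_smult tensor_elt_smult_left
      tensor_elt_smult_right tensor_elt_add_left[of _ A _ _ B] tensor_elt_add_right[of _ A _ B])

lemma tensor_map:
  assumes "multi_matrix A" "multi_matrix B" "f \<in> linear_maps A A'" "g \<in> linear_maps B B'"
  shows "tensor_map A B A' B' f g \<in> linear_maps (tensor A B) (tensor A' B') \<and>
    (\<forall>a\<in>elements A. \<forall>b\<in>elements B. tensor_map A B A' B' f g (tensor_elt a b) = tensor_elt (f a) (g b))"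
proof -
  have i: "\<And>a. a \<in> elements A \<Longrightarrow> f a \<in> elements A'" "\<And>b. b \<in> elements B \<Longrightarrow> g b \<in> elements B'"
    using assms by (auto simp: semilinear_maps_def)
  have l: "\<And>a b. a \<in> elements A \<Longrightarrow> b \<in> elements A \<Longrightarrow> f (alg_add a b) = alg_add (f a) (f b)"
      "\<And>c a. a \<in> elements A \<Longrightarrow> f (alg_smult c a) = alg_smult c (f a)"
      "\<And>a b. a \<in> elements B \<Longrightarrow> b \<in> elements B \<Longrightarrow> g (alg_add a b) = alg_add (g a) (g b)"
      "\<And>c a. a \<in> elements B \<Longrightarrow> g (alg_smult c a) = alg_smult c (g a)"
    using assms by (auto simp: semilinear_maps_def)
  show ?thesis
    unfolding tensor_map_def using assms(1,2)
    by (intro tensor_extensionI) (simp_all add: tensor_elt_in i l tensor_elt_smult_left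
      tensor_elt_smult_right tensor_elt_add_left[of _ A' _ _ B'] tensor_elt_add_right[of _ A' _ B'])
qed

end

(*
  A map out of C^X is determined by its values on the delta_x, so everything is a comparison of the
  blocks of Omega(delta_x), Psi(delta_x) and of a Bayesian inverse R(delta_x).

  The element Omega(delta_x) is positive with E(Omega(delta_x)) = delta_x, so its blocks over y
  different from x are positive of total trace 0 and hence vanish; Omega(E(rho)) = rho then fixes
  the blocks over x.

  Both channel states D[E] and D[R] commute with the respective states: D[E] is a 0/1 combination of
  block identities, and E(rho) tensor 1 is scalar on every block.  So the classical limit axiom
  evaluates both sides of Bayes' rule, which becomes
  tr(F_y(sigma)) R(delta_y) = F_y(sigma) tensor delta_y.  Existence is free because Omega = Psi is a
  channel.  To apply the axiom, the partial trace has to be a channel; its complete positivity rests on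
  rewriting a Gram matrix of n vectors in any dimension as the Gram matrix of n vectors in C^n.
*)
theory Submission
  imports Defs
begin

lemma alg_zero_in [simp]: "alg_zero A \<in> elements A"
  by (simp add: alg_zero_def elements_def)

lemma alg_one_in [simp]: "alg_one A \<in> elements A"
  by (simp add: alg_one_def elements_def)

section \<open>Positive elements\<close>

text \<open>One Gram-Schmidt step: split off the component along the last vector, which leaves \<open>n\<close> vectors.\<close>

lemma gram_square_factor:
  fixes f :: "'w \<Rightarrow> nat \<Rightarrow> complex"
  assumes "finite W"
  shows "\<exists>c. \<forall>i<n. \<forall>j<n. (\<Sum>w\<in>W. cnj (f w i) * f w j) = (\<Sum>k<n. cnj (c k i) * c k j)"
proof (induction n arbitrary: f)
  case 0
  then show ?case by simp
next
  case (Suc n)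
  define G where "G i j = (\<Sum>w\<in>W. cnj (f w i) * f w j)" for i j
  define N where "N = (\<Sum>w\<in>W. (cmod (f w n))\<^sup>2)"
  have GN: "G n n = complex_of_real N"
    by (simp add: G_def N_def complex_norm_square mult.commute del: of_real_power)
  have GH: "cnj (G i j) = G j i" for i j
    by (simp add: G_def mult.commute)
  have N0: "N \<ge> 0" by (simp add: N_def sum_nonneg)
  \<comment> \<open>Vector \<open>i\<close> minus its component along vector \<open>n\<close>. If
    \<open>N = 0\<close>, division by zero returns 0, so \<open>g = f\<close>, and vector
    \<open>n\<close> is then zero anyway.\<close>
  define g where "g w i = f w i - f w n * G n i / N" for w i
  obtain c where c: "\<forall>i<n. \<forall>j<n. (\<Sum>w\<in>W. cnj (g w i) * g w j) = (\<Sum>k<n. cnj (c k i) * c k j)"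
    using Suc.IH by blast
  have zero: "f w n = 0" if "N = 0" "w \<in> W" for w
    using that assms by (simp add: N_def sum_nonneg_eq_0_iff)
  have gn: "g w n = 0" if "w \<in> W" for w
    using zero[OF _ that] by (simp add: g_def GN)
  have gg: "(\<Sum>w\<in>W. cnj (g w i) * g w j) = G i j - G i n * G n j / N" for i j
  proof -
    define t where "t j = G n j / N" for j
    have gt: "g w i = f w i - f w n * t i" for w i by (simp add: g_def t_def)
    have ct: "cnj (t i) = G i n / N" for i by (simp add: t_def GH)
    have "(\<Sum>w\<in>W. cnj (g w i) * g w j) = (\<Sum>w\<in>W. cnj (f w i) * f w j
        - (cnj (f w i) * f w n) * t j - (cnj (f w n) * f w j) * cnj (t i)
        + (cnj (f w n) * f w n) * (cnj (t i) * t j))"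
      by (intro sum.cong refl) (simp add: gt algebra_simps)
    also have "\<dots> = G i j - G i n * t j - G n j * cnj (t i) + G n n * (cnj (t i) * t j)"
      by (simp add: sum.distrib sum_subtractf sum_distrib_right G_def)
    also have "\<dots> = G i j - G i n * G n j / N"
      unfolding ct by (simp add: GN t_def)
    finally show ?thesis .
  qed
  \<comment> \<open>Coordinate \<open>n\<close> holds the components along the normalised last
    vector; the lower coordinates factor the Gram matrix of the residues \<open>g\<close> by the
    induction hypothesis. The last vector has residue zero, hence the middle case.\<close>
  define d where "d k i = (if k = n then G n i / sqrt N else if i = n then 0 else c k i)" for k i
  have sq: "complex_of_real (sqrt N) * complex_of_real (sqrt N) = N"
    using N0 by (metis of_real_mult real_sqrt_mult_self abs_of_nonneg)
  have last: "cnj (d n i) * d n j = G i n * G n j / N" for i j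
    by (simp add: d_def GH sq)
  have main: "G i j = (\<Sum>k<Suc n. cnj (d k i) * d k j)" if ij: "i < Suc n" "j < Suc n" for i j
  proof -
    have "(\<Sum>k<n. cnj (d k i) * d k j) = (\<Sum>w\<in>W. cnj (g w i) * g w j)"
    proof (cases "i = n \<or> j = n")
      case True
      then show ?thesis by (auto simp: d_def gn)
    next
      case False
      then show ?thesis using c ij by (auto simp: d_def)
    qed
    then show ?thesis by (simp add: last gg)
  qed
  show ?case
    by (rule exI[of _ d]) (use main in \<open>simp add: G_def\<close>)
qed

lemma elements_eqI_index:
  assumes "a \<in> elements A" "b \<in> elements A"
    and "\<And>x i j. i < A x \<Longrightarrow> j < A x \<Longrightarrow> a x $$ (i, j) = b x $$ (i, j)"
  shows "a = b"
  by (intro ext eq_matI)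
    (simp_all add: elements_dims[OF assms(1)] elements_dims[OF assms(2)] assms(3))

lemma alg_mult_adjoint_index:
  assumes "c \<in> elements A" "i < A x" "j < A x"
  shows "alg_mult (alg_adjoint c) c x $$ (i, j) = (\<Sum>k<A x. cnj (c x $$ (k, i)) * c x $$ (k, j))"
  using assms(2,3)
  by (simp add: alg_mult_def alg_adjoint_def scalar_prod_def mat_adjoint_index lessThan_atLeast0
      elements_dims[OF assms(1)])

lemma positive_elements: "a \<in> positive A \<Longrightarrow> a \<in> elements A"
  by (auto simp: positive_def alg_mult_in_elements alg_adjoint_in_elements)

lemma positiveE:
  assumes "a \<in> positive A"
  obtains c where "\<And>x i j. i < A x \<Longrightarrow> j < A x \<Longrightarrow>
    a x $$ (i, j) = (\<Sum>k<A x. cnj (c x k i) * c x k j)"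
proof -
  obtain c where "c \<in> elements A" "a = alg_mult (alg_adjoint c) c"
    using assms by (auto simp: positive_def)
  then show thesis using that[of "\<lambda>x k i. c x $$ (k, i)"] by (simp add: alg_mult_adjoint_index)
qed

text \<open>The square factor that \<open>positive\<close> asks for costs nothing:
  \<open>gram_square_factor\<close> replaces a factor with any finite set of rows, block by block.
  Sums of Gram matrices can thus be handled by enlarging \<open>W x\<close>.\<close>

lemma positiveI:
  fixes f :: "'a label \<Rightarrow> 'w \<Rightarrow> nat \<Rightarrow> complex"
  assumes a: "a \<in> elements A" and W: "\<And>x. A x \<noteq> 0 \<Longrightarrow> finite (W x)"
    and f: "\<And>x i j. i < A x \<Longrightarrow> j < A x \<Longrightarrow> a x $$ (i, j) = (\<Sum>w\<in>W x. cnj (f x w i) * f x w j)"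
  shows "a \<in> positive A"
proof -
  have "\<exists>c. \<forall>i<A x. \<forall>j<A x. a x $$ (i, j) = (\<Sum>k<A x. cnj (c k i) * c k j)" for x
  \<comment> \<open>An empty block asks for nothing, and \<open>W x\<close> is known to be finite
    only on the others.\<close>
  proof (cases "A x = 0")
    case False
    then show ?thesis using gram_square_factor[OF W, of x "A x" "f x"] f by auto
  qed simp
  then obtain c where c: "\<And>x i j. i < A x \<Longrightarrow> j < A x \<Longrightarrow>
      a x $$ (i, j) = (\<Sum>k<A x. cnj (c x k i) * c x k j)"
    by metis
  define d where "d = (\<lambda>x. mat (A x) (A x) (\<lambda>(k, i). c x k i))"
  have d: "d \<in> elements A" by (simp add: d_def elements_def)
  have "a = alg_mult (alg_adjoint d) d"
  proof (rule elements_eqI_index[OF a])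
    fix x i j assume ij: "i < A x" "j < A x"
    show "a x $$ (i, j) = alg_mult (alg_adjoint d) d x $$ (i, j)"
      unfolding alg_mult_adjoint_index[of d A, OF d ij] c[OF ij]
      by (rule sum.cong) (use ij in \<open>auto simp: d_def\<close>)
  qed (simp add: d alg_mult_in_elements alg_adjoint_in_elements)
  then show ?thesis using d by (auto simp: positive_def)
qed

lemma positive_adjoint: "a \<in> positive A \<Longrightarrow> alg_adjoint a = a"
proof -
  assume a: "a \<in> positive A"
  note el = positive_elements[OF a]
  obtain c where c: "\<And>x i j. i < A x \<Longrightarrow> j < A x \<Longrightarrow>
      a x $$ (i, j) = (\<Sum>k<A x. cnj (c x k i) * c x k j)"
    using positiveE[OF a] by blast
  show ?thesis
    by (rule elements_eqI_index[OF alg_adjoint_in_elements[OF el] el])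
      (simp add: alg_adjoint_def mat_adjoint_index elements_dims[OF el] c mult.commute)
qed

text \<open>The trace of a block is the sum of the squared moduli of the entries of its Gram factor;
  if that sum is zero, the factor vanishes and the block with it.\<close>

lemma positive_block_trace:
  assumes "a \<in> positive A"
  shows "mat_trace (a x) \<in> \<real>" "Re (mat_trace (a x)) \<ge> 0"
    and "mat_trace (a x) = 0 \<Longrightarrow> a x = 0\<^sub>m (A x) (A x)"
proof -
  note el = elements_dims[OF positive_elements[OF assms]]
  obtain c where c: "\<And>i j. i < A x \<Longrightarrow> j < A x \<Longrightarrow>
      a x $$ (i, j) = (\<Sum>k<A x. cnj (c k i) * c k j)"
    using positiveE[OF assms] by metis
  have t: "mat_trace (a x) = of_real (\<Sum>i<A x. \<Sum>k<A x. (cmod (c k i))\<^sup>2)"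
    by (simp add: mat_trace_def el c complex_norm_square mult.commute del: of_real_power)
  show "mat_trace (a x) \<in> \<real>" "Re (mat_trace (a x)) \<ge> 0"
    unfolding t by (simp_all only: Reals_of_real Re_complex_of_real) (simp add: sum_nonneg)
  assume "mat_trace (a x) = 0"
  then have "(\<Sum>i<A x. \<Sum>k<A x. (cmod (c k i))\<^sup>2) = 0"
    unfolding t of_real_eq_0_iff .
  then have "c k i = 0" if "i < A x" "k < A x" for i k
    using that by (simp add: sum_nonneg_eq_0_iff sum_nonneg)
  then show "a x = 0\<^sub>m (A x) (A x)"
    by (intro eq_matI) (auto simp: el c)
qed

section \<open>Tensor products\<close>

lemma semilinear_maps_in: "h \<in> semilinear_maps s A B \<Longrightarrow> a \<in> elements A \<Longrightarrow> h a \<in> elements B"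
  by (auto simp: semilinear_maps_def)

text \<open>Matrix units of a tensor product are products of matrix units, and their images
  determine a semilinear map. This serves to identify maps given by explicit entries with those
  defined by \<open>tensor_extension\<close>.\<close>

lemma semilinear_tensor_eqI:
  assumes A: "multi_matrix A" and B: "multi_matrix B" and s: "s 0 = 0"
    and g: "g \<in> semilinear_maps s (tensor A B) C" and h: "h \<in> semilinear_maps s (tensor A B) C"
    and eq: "\<And>a b. a \<in> elements A \<Longrightarrow> b \<in> elements B \<Longrightarrow> g (tensor_elt a b) = h (tensor_elt a b)"
  shows "g = h"
proof -
  let ?T = "tensor A B"
  have u: "g (matrix_unit ?T r) = h (matrix_unit ?T r)" if r: "r \<in> unit_labels ?T" for r
  proof -
    obtain p q where pq: "p \<in> unit_labels A" "q \<in> unit_labels B" "r = pair_label B p q"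
      using r pair_label_bij[of B A] by (force simp: bij_betw_def)
    then show ?thesis by (simp add: matrix_unit_tensor eq)
  qed
  have "g z = h z" if z: "z \<in> elements ?T" for z
    unfolding semilinear_expand[OF multi_matrix_tensor[OF A B] z h s]
      semilinear_expand[OF multi_matrix_tensor[OF A B] z g s]
    by (rule alg_sum_cong) (simp add: u)
  then show ?thesis using g h
    by (intro extensionalityI[of _ "elements ?T"]) (auto simp: semilinear_maps_def PiE_def)
qed

lemma tensor_elt_index:
  assumes "a \<in> elements A" "b \<in> elements B" "i < A x * B y" "j < A x * B y"
  shows "tensor_elt a b (Pair x y) $$ (i, j) =
    a x $$ (i div B y, j div B y) * b y $$ (i mod B y, j mod B y)"
  using assms(3,4)
  by (simp add: tensor_elt_def kronecker_def elements_dims[OF assms(1)] elements_dims[OF assms(2)])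

lemma tensor_Pair [simp]: "tensor A B (Pair x y) = A x * B y"
  by (simp add: tensor_def)

lemma tensor_Atom [simp]: "tensor A B (Atom x) = 0"
  by (simp add: tensor_def)

lemma multi_matrix_full [simp]: "multi_matrix (full_matrix l n)"
  by (auto simp: multi_matrix_def full_matrix_def intro: finite_subset[of _ "{l}"])

lemma identity_map_linear: "identity_map A \<in> linear_maps A A"
  by (auto simp: identity_map_def semilinear_maps_def alg_add_in_elements)

section \<open>Positivity of completely positive maps, and images of states\<close>

lemma completely_positive_linear: "\<Phi> \<in> completely_positive A B \<Longrightarrow> \<Phi> \<in> linear_maps A B"
  by (simp add: completely_positive_def)

text \<open>Tensoring with the unit of a one-dimensional algebra only relabels blocks, so complete
  positivity with that ancilla carries positivity from \<open>a\<close> to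
  \<open>\<Phi> a\<close>.\<close>

lemma completely_positive_positive:
  assumes A: "multi_matrix A" and \<Phi>: "\<Phi> \<in> completely_positive A B" and a: "a \<in> positive A"
  shows "\<Phi> a \<in> positive B"
proof -
  obtain l :: "'a label" where True by blast
  let ?M = "full_matrix l (Suc 0)"
  let ?u = "alg_one ?M"
  note lin = completely_positive_linear[OF \<Phi>]
  have ael: "a \<in> elements A" using a by (rule positive_elements)
  have M: "?M x = (if x = l then 1 else 0)" for x by (simp add: full_matrix_def)
  have u: "?u l $$ (0, 0) = 1" by (simp add: alg_one_def full_matrix_def)
  \<comment> \<open>The bound on \<open>i\<close> forces \<open>x = l\<close>, since all other
    blocks of \<open>?M\<close> are empty.\<close>
  have blk: "tensor_elt ?u d (Pair x y) $$ (i, j) = d y $$ (i, j)"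
    if "d \<in> elements D" "i < ?M x * D y" "j < ?M x * D y" for D d x y i j
    using that u by (simp add: tensor_elt_index[OF alg_one_in that(1)] M split: if_splits)
  obtain c where c: "\<And>x i j. i < A x \<Longrightarrow> j < A x \<Longrightarrow>
      a x $$ (i, j) = (\<Sum>k<A x. cnj (c x k i) * c x k j)"
    using positiveE[OF a] by blast
  have "tensor_elt ?u a \<in> positive (tensor ?M A)"
  \<comment> \<open>The factor of \<open>a\<close> at \<open>y\<close> serves for the pair
    \<open>Pair l y\<close>; the \<open>Atom\<close> branches concern empty blocks.\<close>
  proof (rule positiveI[where W = "\<lambda>z. case z of Pair x y \<Rightarrow> {..<A y} | Atom _ \<Rightarrow> {}"
        and f = "\<lambda>z. case z of Pair x y \<Rightarrow> c y | Atom _ \<Rightarrow> c z"])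
    fix z i j assume ij: "i < tensor ?M A z" "j < tensor ?M A z"
    then obtain x y where z: "z = Pair x y" by (cases z) auto
    show "tensor_elt ?u a z $$ (i, j) =
      (\<Sum>w\<in>(case z of Pair x y \<Rightarrow> {..<A y} | Atom _ \<Rightarrow> {}).
        cnj ((case z of Pair x y \<Rightarrow> c y | Atom _ \<Rightarrow> c z) w i) *
        (case z of Pair x y \<Rightarrow> c y | Atom _ \<Rightarrow> c z) w j)"
      using ij by (simp add: z blk[OF ael] c M split: if_splits)
  qed (auto simp: ael tensor_elt_in split: label.splits)
  then have "tensor_map ?M A ?M B (identity_map ?M) \<Phi> (tensor_elt ?u a) \<in> positive (tensor ?M B)"
    using \<Phi> unfolding completely_positive_def Let_def by simp
  then have P: "tensor_elt ?u (\<Phi> a) \<in> positive (tensor ?M B)"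
    using tensor_map[OF multi_matrix_full A identity_map_linear lin, of l "Suc 0"] ael
    by (simp add: identity_map_def)
  note \<Phi>a = semilinear_maps_in[OF lin ael]
  obtain c where c: "\<And>z i j. i < tensor ?M B z \<Longrightarrow> j < tensor ?M B z \<Longrightarrow>
      tensor_elt ?u (\<Phi> a) z $$ (i, j) = (\<Sum>k<tensor ?M B z. cnj (c z k i) * c z k j)"
    using positiveE[OF P] by blast
  show ?thesis
  proof (rule positiveI[where W = "\<lambda>y. {..<B y}" and f = "\<lambda>y. c (Pair l y)"])
    fix y i j assume "i < B y" "j < B y"
    then show "\<Phi> a y $$ (i, j) = (\<Sum>w<B y. cnj (c (Pair l y) w i) * c (Pair l y) w j)"
      using c[of i "Pair l y" j] blk[OF \<Phi>a, of i l y j] by (simp add: M)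
  qed (simp_all add: \<Phi>a)
qed

lemma CPTP_state:
  assumes "multi_matrix A" "\<Phi> \<in> CPTP A B" "a \<in> states A" shows "\<Phi> a \<in> states B"
  using assms completely_positive_positive[of A \<Phi> B a] positive_elements[of a A]
  by (auto simp: CPTP_def states_def)

section \<open>The channel state\<close>

text \<open>Pairing with a matrix unit reads off an entry, so the defining identity of the adjoint
  is tested against \<open>matrix_unit A p\<close>.\<close>

lemma entry_hs_adjoint:
  assumes "multi_matrix A" "multi_matrix B" "\<Phi> \<in> linear_maps A B" "b \<in> elements B"
    and p: "p \<in> unit_labels A"
  shows "entry (hs_adjoint A B \<Phi> b) p = alg_trace B (alg_mult (alg_adjoint (\<Phi> (matrix_unit A p))) b)"
proof -
  have in': "hs_adjoint A B \<Phi> b \<in> elements A"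
    using hs_adjoint(1)[OF assms(1-3)] assms(4) by (rule semilinear_maps_in)
  have "(\<Sum>r\<in>unit_labels A. cnj (entry (matrix_unit A p) r) * entry (hs_adjoint A B \<Phi> b) r) =
      (\<Sum>r\<in>unit_labels A. if r = p then entry (hs_adjoint A B \<Phi> b) r else 0)"
    by (rule sum.cong) (auto simp: entry_matrix_unit)
  then show ?thesis
    using hs_adjoint(2)[OF assms(1-3) matrix_unit_in assms(4)] p assms(1)
    by (simp add: hs_inner in' sum.delta)
qed

lemma matrix_unit_mult:
  assumes "(x, i, j) \<in> unit_labels A" "(y, k, l) \<in> unit_labels A"
  shows "alg_mult (matrix_unit A (x, i, j)) (matrix_unit A (y, k, l)) =
    (if x = y \<and> j = k then matrix_unit A (x, i, l) else alg_zero A)"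
proof (rule elements_eqI_index[of _ A])
  fix z m n assume mn: "m < A z" "n < A z"
  have "alg_mult (matrix_unit A (x, i, j)) (matrix_unit A (y, k, l)) z $$ (m, n) =
      (\<Sum>r<A z. (if (z, m, r) = (x, i, j) then 1 else 0) * (if (z, r, n) = (y, k, l) then 1 else 0))"
    using mn by (simp add: alg_mult_def matrix_unit_def scalar_prod_def lessThan_atLeast0)
  also have "\<dots> = (\<Sum>r<A z. if r = j then (if z = x \<and> m = i \<and> z = y \<and> j = k \<and> n = l then 1 else 0) else 0)"
    by (rule sum.cong) auto
  also have "\<dots> = (if z = x \<and> m = i \<and> z = y \<and> j = k \<and> n = l then 1 else 0)"
    using assms by (auto simp: sum.delta unit_labels_def)
  finally show "alg_mult (matrix_unit A (x, i, j)) (matrix_unit A (y, k, l)) z $$ (m, n) =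
      (if x = y \<and> j = k then matrix_unit A (x, i, l) else alg_zero A) z $$ (m, n)"
    using mn by (auto simp: matrix_unit_def alg_zero_def)
qed (auto simp: alg_mult_in_elements)

lemma pair_label_in:
  "p \<in> unit_labels A \<Longrightarrow> q \<in> unit_labels B \<Longrightarrow> pair_label B p q \<in> unit_labels (tensor A B)"
  using pair_label_bij[of B A] by (force simp: bij_betw_def)

lemma alg_trace_adjoint_matrix_unit:
  assumes "multi_matrix A" "(x, i, j) \<in> unit_labels A"
  shows "alg_trace A (alg_mult (alg_adjoint (matrix_unit A (x, i, j))) (alg_one A)) =
    (if i = j then 1 else 0)"
proof -
  have "alg_trace A (alg_mult (alg_adjoint (matrix_unit A (x, i, j))) (alg_one A)) =
     (\<Sum>p\<in>unit_labels A. if p = (x, i, j) then (if i = j then 1 else 0) else 0)"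
    unfolding hs_inner[OF assms(1) matrix_unit_in alg_one_in]
    by (rule sum.cong) (auto simp: entry_matrix_unit, auto simp: entry_def alg_one_def unit_labels_def)
  then show ?thesis using assms by (simp add: sum.delta)
qed

text \<open>By \<open>entry_hs_adjoint\<close>, the coefficient of E_ij tensor E_kl is the trace of
  the adjoint of E_ij E_kl. It is 1 if both units lie in the same block with j = k and i = l, and 0
  otherwise.\<close>

lemma mult_adjoint_one:
  assumes A: "multi_matrix A"
  shows "hs_adjoint (tensor A A) A (multiplication_map A) (alg_one A) =
    alg_sum (tensor A A) (\<lambda>(x, i, j). tensor_elt (matrix_unit A (x, i, j)) (matrix_unit A (x, j, i)))
      (unit_labels A)" (is "?l = ?r")
proof (rule elements_eqI[of _ "tensor A A"])
  note T = multi_matrix_tensor[OF A A]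
  note \<mu> = multiplication_map[OF A]
  show "?l \<in> elements (tensor A A)"
    using hs_adjoint(1)[OF T A conjunct1[OF \<mu>]] by (rule semilinear_maps_in) simp
  fix r assume "r \<in> unit_labels (tensor A A)"
  then obtain x i j y k l where pq: "(x, i, j) \<in> unit_labels A" "(y, k, l) \<in> unit_labels A"
      "r = pair_label A (x, i, j) (y, k, l)"
    using pair_label_bij[of A A] by (force simp: bij_betw_def)
  have z: "alg_trace A (alg_mult (alg_adjoint (alg_zero A)) (alg_one A)) = 0"
    unfolding hs_inner[OF A alg_zero_in alg_one_in]
    by (rule sum.neutral) (auto simp: alg_zero_def entry_def unit_labels_def)
  have "(x, i, l) \<in> unit_labels A" if "x = y" using pq that by (auto simp: unit_labels_def)
  then have "entry ?l r = (if x = y \<and> j = k \<and> i = l then 1 else 0)"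
    using pq \<mu> by (auto simp: entry_hs_adjoint[OF T A] pair_label_in matrix_unit_tensor
      matrix_unit_mult alg_trace_adjoint_matrix_unit[OF A] z)
  also have "\<dots> = (\<Sum>p\<in>unit_labels A. if p = (x, i, j) then (if x = y \<and> j = k \<and> i = l then 1 else 0) else 0)"
    using pq A by (simp add: sum.delta)
  also have "\<dots> = entry ?r r"
    using pq by (auto simp: entry_alg_sum pair_label_in entry_tensor entry_matrix_unit split: prod.splits
      intro!: sum.cong)
  finally show "entry ?l r = entry ?r r" .
qed simp

text \<open>Applying \<open>\<Phi>\<close> to the second factors in \<open>mult_adjoint_one\<close>
  gives the sum of E_ij tensor \<open>\<Phi>\<close>(E_ji). This is the Jamiolkowski matrix, hence
  the swap of \<open>i\<close> and \<open>j\<close> that the Choi matrix does not have.\<close>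

lemma entry_channel_state:
  assumes A: "multi_matrix A" and \<Phi>: "\<Phi> \<in> linear_maps A B"
    and p: "(x, i, j) \<in> unit_labels A" and q: "q \<in> unit_labels B"
  shows "entry (channel_state A B \<Phi>) (pair_label B (x, i, j) q) = entry (\<Phi> (matrix_unit A (x, j, i))) q"
proof -
  note tm = tensor_map[OF A A identity_map_linear \<Phi>]
  have "channel_state A B \<Phi> = alg_sum (tensor A B)
      (\<lambda>(x, i, j). tensor_elt (matrix_unit A (x, i, j)) (\<Phi> (matrix_unit A (x, j, i)))) (unit_labels A)"
    unfolding channel_state_def mult_adjoint_one[OF A] using tm A
    by (subst semilinear_sum[OF conjunct1[OF tm]])
      (auto simp: tensor_elt_in identity_map_def intro!: alg_sum_cong)
  then have "entry (channel_state A B \<Phi>) (pair_label B (x, i, j) q) =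
      (\<Sum>r\<in>unit_labels A. if r = (x, i, j) then entry (\<Phi> (matrix_unit A (x, j, i))) q else 0)"
    using p q semilinear_maps_in[OF \<Phi>]
    by (auto simp: entry_alg_sum pair_label_in entry_tensor entry_matrix_unit split: prod.splits
      intro!: sum.cong)
  then show ?thesis using p A by (simp add: sum.delta)
qed

lemma channel_state_in:
  assumes A: "multi_matrix A" and \<Phi>: "\<Phi> \<in> linear_maps A B"
  shows "channel_state A B \<Phi> \<in> elements (tensor A B)"
  unfolding channel_state_def mult_adjoint_one[OF A]
  using semilinear_maps_in[OF conjunct1[OF tensor_map[OF A A identity_map_linear \<Phi>]]] by simp

section \<open>Partial trace and time reversal\<close>

lemma unit_labels_iff: "(x, i, j) \<in> unit_labels A \<longleftrightarrow> i < A x \<and> j < A x"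
  by (auto simp: unit_labels_def)

lemma mult_add_div_mod:
  fixes q r n :: nat
  assumes "r < n" shows "(q * n + r) div n = q" "(q * n + r) mod n = r"
  using assms by simp_all

text \<open>The partial trace, its extension by an identity, and time reversal all have entries that
  are sums of plain or conjugated entries of the argument, read at positions \<open>r\<close>. Their
  semilinearity is checked here once.\<close>

lemma reindex_semilinear:
  assumes add: "\<And>c d. s (c + d) = s c + s d" and mult: "\<And>c d. s (c * d) = s c * s d"
    and r: "\<And>y i j k. i < C y \<Longrightarrow> j < C y \<Longrightarrow> k \<in> K y \<Longrightarrow> r y i j k \<in> unit_labels A"
    and g: "g = restrict (\<lambda>z y. mat (C y) (C y) (\<lambda>(i, j). \<Sum>k\<in>K y. s (entry z (r y i j k)))) (elements A)"
  shows "g \<in> semilinear_maps s A C"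
proof -
  have in': "g z \<in> elements C" if "z \<in> elements A" for z
    using that by (simp add: g elements_def)
  have idx: "g z y $$ (i, j) = (\<Sum>k\<in>K y. s (entry z (r y i j k)))"
    if "z \<in> elements A" "i < C y" "j < C y" for z y i j
    using that by (simp add: g)
  have 1: "g (alg_add a b) = alg_add (g a) (g b)" if ab: "a \<in> elements A" "b \<in> elements A" for a b
  proof (rule elements_eqI_index[of _ C])
    fix y i j assume ij: "i < C y" "j < C y"
    show "g (alg_add a b) y $$ (i, j) = alg_add (g a) (g b) y $$ (i, j)"
      unfolding idx[OF alg_add_in_elements[OF ab] ij]
      using ij by (simp add: alg_add_def[of "g a"] elements_dims[OF in'[OF ab(2)]] idx[OF ab(1) ij]
        idx[OF ab(2) ij] entry_alg_add[OF r[OF ij] ab(2)] add sum.distrib)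
  qed (simp_all add: in' ab alg_add_in_elements)
  have 2: "g (alg_smult c a) = alg_smult (s c) (g a)" if a: "a \<in> elements A" for c a
  proof (rule elements_eqI_index[of _ C])
    fix y i j assume ij: "i < C y" "j < C y"
    show "g (alg_smult c a) y $$ (i, j) = alg_smult (s c) (g a) y $$ (i, j)"
      unfolding idx[OF alg_smult_in_elements[OF a] ij]
      using ij by (simp add: alg_smult_def[of _ "g a"] elements_dims[OF in'[OF a]] idx[OF a ij]
        sum_distrib_left entry_alg_smult[OF r[OF ij] a] mult)
  qed (simp_all add: in' a)
  have "g \<in> elements A \<rightarrow>\<^sub>E elements C"
    using in' by (auto simp: g)
  then show ?thesis
    using 1 2 by (simp add: semilinear_maps_def)
qed

text \<open>\<open>trace_left\<close> is only described by its values on products. The map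
  \<open>g\<close> with the claimed entries is linear and has the same values, so it is the same
  map. Position \<open>k * B y + i\<close> pairs index \<open>k\<close> of the first factor with
  \<open>i\<close> of the second.\<close>

lemma trace_left_index:
  assumes A: "multi_matrix A" and B: "multi_matrix B" and z: "z \<in> elements (tensor A B)"
    and ij: "i < B y" "j < B y"
  shows "trace_left A B z y $$ (i, j) =
    (\<Sum>x | A x \<noteq> 0. \<Sum>k<A x. z (Pair x y) $$ (k * B y + i, k * B y + j))"
proof -
  let ?K = "SIGMA x:{x. A x \<noteq> 0}. {..<A x}"
  let ?r = "\<lambda>y i j (x, k). (Pair x y, k * B y + i, k * B y + j)"
  define g where "g = restrict (\<lambda>z y. mat (B y) (B y) (\<lambda>(i, j). \<Sum>k\<in>?K. entry z (?r y i j k)))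
    (elements (tensor A B))"
  have fin: "finite {x. A x \<noteq> 0}" using A by (simp add: multi_matrix_def)
  have g: "g \<in> linear_maps (tensor A B) B"
    by (rule reindex_semilinear[OF _ _ _ g_def]) (auto simp: unit_labels_iff mult_add_less_mult)
  have idx: "g z y $$ (i, j) = (\<Sum>x | A x \<noteq> 0. \<Sum>k<A x. z (Pair x y) $$ (k * B y + i, k * B y + j))"
    if "z \<in> elements (tensor A B)" "i < B y" "j < B y" for z y i j
    using that fin by (simp add: g_def entry_def split_beta sum.Sigma)
  have "g = trace_left A B"
  proof (rule semilinear_tensor_eqI[OF A B _ g])
    fix a b assume a: "a \<in> elements A" and b: "b \<in> elements B"
    have "g (tensor_elt a b) = alg_smult (alg_trace A a) b"
    proof (rule elements_eqI_index[of _ B])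
      fix y i j assume ij: "i < B y" "j < B y"
      have "g (tensor_elt a b) y $$ (i, j) = (\<Sum>x | A x \<noteq> 0. \<Sum>k<A x. a x $$ (k, k) * b y $$ (i, j))"
        unfolding idx[OF tensor_elt_in[OF a b] ij]
        using ij by (intro sum.cong refl) (simp add: tensor_elt_index[OF a b] mult_add_less_mult)
      also have "\<dots> = alg_smult (alg_trace A a) b y $$ (i, j)"
        using ij by (simp add: alg_smult_def alg_trace_def mat_trace_def elements_dims[OF a]
          elements_dims[OF b] sum_distrib_right)
      finally show "g (tensor_elt a b) y $$ (i, j) = alg_smult (alg_trace A a) b y $$ (i, j)" .
    qed (use a b in \<open>simp_all add: semilinear_maps_in[OF g] tensor_elt_in\<close>)
    then show "g (tensor_elt a b) = trace_left A B (tensor_elt a b)"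
      using trace_left[OF A B] a b by simp
  qed (use trace_left[OF A B] in simp_all)
  then show ?thesis using idx[OF z ij] by simp
qed

text \<open>An index of \<open>tensor M B\<close> splits by \<open>div\<close> and
  \<open>mod\<close> into its two halves; \<open>f\<close> inserts the index \<open>k\<close> of the
  traced-out middle factor between them. The formula then follows by comparison on products, as for
  \<open>trace_left_index\<close>.\<close>

lemma id_trace_left_index:
  fixes M A B :: "'a algebra"
  defines "f \<equiv> \<lambda>x y i k. (i div B y) * (A x * B y) + (k * B y + i mod B y)"
  assumes M: "multi_matrix M" and A: "multi_matrix A" and B: "multi_matrix B"
    and z: "z \<in> elements (tensor M (tensor A B))"
    and ij: "i < M l * B y" "j < M l * B y"
  shows "tensor_map M (tensor A B) M B (identity_map M) (trace_left A B) z (Pair l y) $$ (i, j) =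
    (\<Sum>x | A x \<noteq> 0. \<Sum>k<A x. z (Pair l (Pair x y)) $$ (f x y i k, f x y j k))"
proof -
  let ?T = "tensor M (tensor A B)"
  let ?h = "tensor_map M (tensor A B) M B (identity_map M) (trace_left A B)"
  let ?K = "SIGMA x:{x. A x \<noteq> 0}. {..<A x}"
  let ?r = "\<lambda>v i j (x, k). case v of
    Pair l y \<Rightarrow> (Pair l (Pair x y), f x y i k, f x y j k) | Atom _ \<Rightarrow> (v, i, j)"
  define g where "g = restrict (\<lambda>z v. mat (tensor M B v) (tensor M B v)
    (\<lambda>(i, j). \<Sum>k\<in>?K. entry z (?r v i j k))) (elements ?T)"
  note AB = multi_matrix_tensor[OF A B]
  have fin: "finite {x. A x \<noteq> 0}" using A by (simp add: multi_matrix_def)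
  note t = trace_left[OF A B]
  note tm = tensor_map[OF M AB identity_map_linear conjunct1[OF t]]
  have bound: "f x y i k < M l * (A x * B y)" "k * B y + i mod B y < A x * B y"
    if "i < M l * B y" "k < A x" for x y i k l
    using that div_mod_less[OF that(1)] unfolding f_def
    by (auto intro!: mult_add_less_mult)
  \<comment> \<open>Dividing by the size of the inner block undoes the insertion, as
    \<open>tensor_elt_index\<close> requires.\<close>
  have dm: "f x y i k div (A x * B y) = i div B y" "f x y i k mod (A x * B y) = k * B y + i mod B y"
    if "i < M l * B y" "k < A x" for x y i k l
    unfolding f_def by (rule mult_add_div_mod[OF bound(2)[OF that]])+
  have g: "g \<in> linear_maps ?T (tensor M B)"
  proof (rule reindex_semilinear[OF _ _ _ g_def])
    fix v i j k assume v: "i < tensor M B v" "j < tensor M B v" "k \<in> ?K"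
    then obtain l y where "v = Pair l y" by (cases v) auto
    then show "?r v i j k \<in> unit_labels ?T"
      using v bound by (auto simp: unit_labels_iff)
  qed auto
  have idx: "g z (Pair l y) $$ (i, j) =
      (\<Sum>x | A x \<noteq> 0. \<Sum>k<A x. z (Pair l (Pair x y)) $$ (f x y i k, f x y j k))"
    if "z \<in> elements ?T" "i < M l * B y" "j < M l * B y" for z l y i j
    using that fin by (simp add: g_def entry_def split_beta sum.Sigma)
  have "g = ?h"
  proof (rule semilinear_tensor_eqI[OF M AB _ g])
    fix m a assume m: "m \<in> elements M" and a: "a \<in> elements (tensor A B)"
    note ta = semilinear_maps_in[OF conjunct1[OF t] a]
    have "g (tensor_elt m a) = tensor_elt m (trace_left A B a)"
    proof (rule elements_eqI_index[of _ "tensor M B"])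
      fix v i j assume v: "i < tensor M B v" "j < tensor M B v"
      then obtain l y where v_eq [simp]: "v = Pair l y" by (cases v) auto
      from v have ij: "i < M l * B y" "j < M l * B y" by simp_all
      have "g (tensor_elt m a) v $$ (i, j) = (\<Sum>x | A x \<noteq> 0. \<Sum>k<A x.
          m l $$ (i div B y, j div B y) * a (Pair x y) $$ (k * B y + i mod B y, k * B y + j mod B y))"
        unfolding v_eq idx[OF tensor_elt_in[OF m a] ij]
        using ij by (intro sum.cong refl) (simp add: tensor_elt_index[OF m a] bound dm)
      also have "\<dots> = tensor_elt m (trace_left A B a) v $$ (i, j)"
        using div_mod_less[OF ij(1)] div_mod_less[OF ij(2)]
        by (simp add: tensor_elt_index[OF m ta ij] trace_left_index[OF A B a] sum_distrib_left)
      finally show "g (tensor_elt m a) v $$ (i, j) = tensor_elt m (trace_left A B a) v $$ (i, j)" .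
    qed (use m a ta in \<open>simp_all add: semilinear_maps_in[OF g] tensor_elt_in\<close>)
    then show "g (tensor_elt m a) = ?h (tensor_elt m a)"
      using tm m a by (simp add: identity_map_def)
  qed (use tm in simp_all)
  then show ?thesis using idx[OF z ij] by simp
qed

section \<open>The partial trace as a channel\<close>

lemma alg_trace_tensor:
  assumes z: "z \<in> elements (tensor A B)"
  shows "alg_trace (tensor A B) z = (\<Sum>x | A x \<noteq> 0. \<Sum>y | B y \<noteq> 0. \<Sum>k<A x. \<Sum>i<B y.
    z (Pair x y) $$ (k * B y + i, k * B y + i))"
proof -
  have eq: "{v. tensor A B v \<noteq> 0} = (\<lambda>(x, y). Pair x y) ` ({x. A x \<noteq> 0} \<times> {y. B y \<noteq> 0})"
  proof (intro equalityI subsetI)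
    fix v assume "v \<in> {v. tensor A B v \<noteq> 0}"
    then show "v \<in> (\<lambda>(x, y). Pair x y) ` ({x. A x \<noteq> 0} \<times> {y. B y \<noteq> 0})"
      by (cases v) auto
  qed auto
  have block: "mat_trace (z (Pair x y)) = (\<Sum>k<A x. \<Sum>i<B y. z (Pair x y) $$ (k * B y + i, k * B y + i))"
    for x y
  proof -
    \<comment> \<open>The diagonal of length \<open>A x * B y\<close> is cut into \<open>A x\<close>
      runs of length \<open>B y\<close>.\<close>
    have "mat_trace (z (Pair x y)) = (\<Sum>k<A x. \<Sum>i=k * B y..<k * B y + B y. z (Pair x y) $$ (i, i))"
      by (simp add: mat_trace_def elements_dims[OF z] sum.nat_group)
    also have "\<dots> = (\<Sum>k<A x. \<Sum>i<B y. z (Pair x y) $$ (k * B y + i, k * B y + i))"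
      by (subst sum.atLeastLessThan_shift_0) (simp add: lessThan_atLeast0)
    finally show ?thesis .
  qed
  have "alg_trace (tensor A B) z = (\<Sum>(x, y)\<in>{x. A x \<noteq> 0} \<times> {y. B y \<noteq> 0}. mat_trace (z (Pair x y)))"
    unfolding alg_trace_def eq by (subst sum.reindex) (auto simp: inj_on_def intro!: sum.cong)
  then show ?thesis by (simp add: sum.cartesian_product block)
qed

text \<open>Trace preservation is an exchange of sums. For complete positivity, the partial trace
  sums, over \<open>x\<close> and \<open>k\<close>, matrices whose rows and columns are selected
  from \<open>z\<close> by the same rule \<open>f\<close>. Each of these is again a Gram matrix, and
  \<open>positiveI\<close> absorbs the sum into a longer row index.\<close>

lemma trace_left_CPTP:
  assumes A: "multi_matrix A" and B: "multi_matrix B"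
  shows "trace_left A B \<in> CPTP (tensor A B) B"
proof -
  note t = conjunct1[OF trace_left[OF A B]]
  have fin: "finite {x. A x \<noteq> 0}" using A by (simp add: multi_matrix_def)
  have tr: "alg_trace B (trace_left A B z) = alg_trace (tensor A B) z" if z: "z \<in> elements (tensor A B)" for z
  proof -
    have "alg_trace B (trace_left A B z) = (\<Sum>y | B y \<noteq> 0. \<Sum>i<B y. \<Sum>x | A x \<noteq> 0. \<Sum>k<A x.
        z (Pair x y) $$ (k * B y + i, k * B y + i))"
      by (simp add: alg_trace_def mat_trace_def elements_dims[OF semilinear_maps_in[OF t z]]
        trace_left_index[OF A B z])
    also have "\<dots> = (\<Sum>y | B y \<noteq> 0. \<Sum>x | A x \<noteq> 0. \<Sum>i<B y. \<Sum>k<A x.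
        z (Pair x y) $$ (k * B y + i, k * B y + i))"
      by (intro sum.cong refl sum.swap)
    also have "\<dots> = (\<Sum>x | A x \<noteq> 0. \<Sum>y | B y \<noteq> 0. \<Sum>i<B y. \<Sum>k<A x.
        z (Pair x y) $$ (k * B y + i, k * B y + i))"
      by (rule sum.swap)
    also have "\<dots> = (\<Sum>x | A x \<noteq> 0. \<Sum>y | B y \<noteq> 0. \<Sum>k<A x. \<Sum>i<B y.
        z (Pair x y) $$ (k * B y + i, k * B y + i))"
      by (intro sum.cong refl sum.swap)
    finally show ?thesis by (simp add: alg_trace_tensor[OF z])
  qed
  have pos: "tensor_map M (tensor A B) M B (identity_map M) (trace_left A B) z \<in> positive (tensor M B)"
    (is "?h z \<in> _") if M: "multi_matrix M" and z: "z \<in> positive (tensor M (tensor A B))" for M z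
  proof -
    note zel = positive_elements[OF z]
    obtain c where c: "\<And>x i j. i < tensor M (tensor A B) x \<Longrightarrow> j < tensor M (tensor A B) x \<Longrightarrow>
        z x $$ (i, j) = (\<Sum>w<tensor M (tensor A B) x. cnj (c x w i) * c x w j)"
      using positiveE[OF z] by blast
    define f where "f = (\<lambda>x y i k. (i div B y) * (A x * B y) + (k * B y + i mod B y))"
    \<comment> \<open>A row \<open>(x, k, w)\<close> of the new factor is row \<open>w\<close> of
      the factor of \<open>z\<close> in the block over \<open>x\<close>, read at the positions
      \<open>f x y i k\<close> with \<open>k\<close> fixed.\<close>
    define W where "W = (\<lambda>v. case v of
      Pair l y \<Rightarrow> (SIGMA x:{x. A x \<noteq> 0}. {..<A x} \<times> {..<M l * (A x * B y)}) | Atom _ \<Rightarrow> {})"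
    define d where "d = (\<lambda>v (x, k, w) i. case v of
      Pair l y \<Rightarrow> c (Pair l (Pair x y)) w (f x y i k) | Atom _ \<Rightarrow> 0)"
    show ?thesis
    proof (rule positiveI[of _ _ W d])
      show "?h z \<in> elements (tensor M B)"
        using tensor_map[OF M multi_matrix_tensor[OF A B] identity_map_linear t] zel
        by (auto intro: semilinear_maps_in)
      show "finite (W v)" for v using fin by (auto simp: W_def split: label.split)
      fix v i j assume v: "i < tensor M B v" "j < tensor M B v"
      then obtain l y where v_eq [simp]: "v = Pair l y" by (cases v) auto
      from v have ij: "i < M l * B y" "j < M l * B y" by simp_all
      have bound: "f x y i k < M l * (A x * B y)" if "i < M l * B y" "k < A x" for x i k
        using that div_mod_less[OF that(1)] unfolding f_def
        by (auto intro!: mult_add_less_mult)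
      have "?h z v $$ (i, j) = (\<Sum>x | A x \<noteq> 0. \<Sum>k<A x. z (Pair l (Pair x y)) $$ (f x y i k, f x y j k))"
        using id_trace_left_index[OF M A B zel ij] by (simp add: f_def)
      also have "\<dots> = (\<Sum>x | A x \<noteq> 0. \<Sum>k<A x. \<Sum>w<M l * (A x * B y).
          cnj (d v (x, k, w) i) * d v (x, k, w) j)"
        by (intro sum.cong refl) (simp add: c bound ij d_def)
      also have "\<dots> = (\<Sum>w\<in>W v. cnj (d v w i) * d v w j)"
        unfolding W_def using fin
        by (simp add: sum.cartesian_product sum.Sigma split_beta)
      finally show "?h z v $$ (i, j) = (\<Sum>w\<in>W v. cnj (d v w i) * d v w j)" .
    qed
  qed
  show ?thesis
    unfolding CPTP_def completely_positive_def Let_def using t tr pos by auto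
qed

text \<open>Exchanging the tensor factors exchanges the \<open>div\<close> and \<open>mod\<close>
  parts of an index; the adjoints conjugate the entry and exchange row and column.\<close>

lemma time_reversal_index:
  assumes A: "multi_matrix A" and B: "multi_matrix B" and z: "z \<in> elements (tensor B A)"
    and ij: "i < A x * B y" "j < A x * B y"
  shows "time_reversal B A z (Pair x y) $$ (i, j) =
    cnj (z (Pair y x) $$ (j mod B y * A x + j div B y, i mod B y * A x + i div B y))"
proof -
  \<comment> \<open>The dummy index in \<open>unit\<close> makes the single entry a one-term sum,
    the shape that \<open>reindex_semilinear\<close> handles.\<close>
  let ?r = "\<lambda>v i j (k::unit). case v of
    Pair x y \<Rightarrow> (Pair y x, j mod B y * A x + j div B y, i mod B y * A x + i div B y) | Atom _ \<Rightarrow> (v, i, j)"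
  define g where "g = restrict (\<lambda>z v. mat (tensor A B v) (tensor A B v)
    (\<lambda>(i, j). \<Sum>k\<in>UNIV. cnj (entry z (?r v i j k)))) (elements (tensor B A))"
  have bound: "i mod B y * A x + i div B y < B y * A x" if "i < A x * B y" for i x y
    using div_mod_less[OF that] by (intro mult_add_less_mult)
  have g: "g \<in> antilinear_maps (tensor B A) (tensor A B)"
  proof (rule reindex_semilinear[OF _ _ _ g_def])
    fix v i j k assume v: "i < tensor A B v" "j < tensor A B v"
    then obtain x y where "v = Pair x y" by (cases v) auto
    then show "?r v i j k \<in> unit_labels (tensor B A)"
      using v bound by (auto simp: unit_labels_iff)
  qed auto
  have idx: "g z (Pair x y) $$ (i, j) =
      cnj (z (Pair y x) $$ (j mod B y * A x + j div B y, i mod B y * A x + i div B y))"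
    if "z \<in> elements (tensor B A)" "i < A x * B y" "j < A x * B y" for z x y i j
    using that by (simp add: g_def entry_def)
  note tr = time_reversal[OF A B]
  have "g = time_reversal B A"
  proof (rule semilinear_tensor_eqI[OF B A _ g])
    fix b a assume b: "b \<in> elements B" and a: "a \<in> elements A"
    note ad = alg_adjoint_in_elements[OF a] alg_adjoint_in_elements[OF b]
    have "g (tensor_elt b a) = tensor_elt (alg_adjoint a) (alg_adjoint b)"
    proof (rule elements_eqI_index[of _ "tensor A B"])
      fix v i j assume v: "i < tensor A B v" "j < tensor A B v"
      then obtain x y where v_eq [simp]: "v = Pair x y" by (cases v) auto
      from v have ij: "i < A x * B y" "j < A x * B y" by simp_all
      show "g (tensor_elt b a) v $$ (i, j) = tensor_elt (alg_adjoint a) (alg_adjoint b) v $$ (i, j)"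
        unfolding v_eq idx[OF tensor_elt_in[OF b a] ij] tensor_elt_index[OF ad ij]
        using ij div_mod_less[OF ij(1)] div_mod_less[OF ij(2)]
        by (simp add: tensor_elt_index[OF b a]
          bound alg_adjoint_def mat_adjoint_index elements_dims[OF a] elements_dims[OF b])
    qed (simp_all add: semilinear_maps_in[OF g] tensor_elt_in a b ad)
    then show "g (tensor_elt b a) = time_reversal B A (tensor_elt b a)"
      using tr a b by simp
  qed (use tr in simp_all)
  then show ?thesis using idx[OF z ij] by simp
qed

section \<open>Classical algebras\<close>

lemma elements_eqI_block:
  assumes "a \<in> elements A" "b \<in> elements A" "\<And>x. A x \<noteq> 0 \<Longrightarrow> a x = b x"
  shows "a = b"
  using assms by (intro elements_eqI_index[OF assms(1,2)]) simp

lemma multi_matrix_classical: "finite X \<Longrightarrow> multi_matrix (classical X)"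
  by (auto simp: multi_matrix_def classical_def intro: finite_subset[of _ X])

lemma classical_eq_1: "x \<in> X \<Longrightarrow> classical X x = 1"
  by (simp add: classical_def)

lemma delta_in [simp]: "delta X x \<in> elements (classical X)"
  by (simp add: delta_def elements_def)

lemma delta_index: "x \<in> X \<Longrightarrow> delta X y x $$ (0, 0) = (if x = y then 1 else 0)"
  by (simp add: delta_def classical_def)

lemma delta_eq_matrix_unit: "delta X x = matrix_unit (classical X) (x, 0, 0)"
  by (rule elements_eqI_index[OF delta_in matrix_unit_in])
    (auto simp: delta_def matrix_unit_def classical_def split: if_splits)

lemma unit_labels_classical: "unit_labels (classical X) = (\<lambda>x. (x, 0, 0)) ` X"
  by (auto simp: unit_labels_def classical_def split: if_splits)

lemma linear_classical_index:
  assumes X: "finite X" and h: "h \<in> linear_maps (classical X) D" and c: "c \<in> elements (classical X)"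
    and ij: "i < D y" "j < D y"
  shows "h c y $$ (i, j) = (\<Sum>x\<in>X. c x $$ (0, 0) * h (delta X x) y $$ (i, j))"
proof -
  have p: "(y, i, j) \<in> unit_labels D" using ij by (simp add: unit_labels_iff)
  have "entry (h c) (y, i, j) = (\<Sum>x\<in>X. entry (alg_smult (c x $$ (0, 0)) (h (delta X x))) (y, i, j))"
    unfolding semilinear_expand[OF multi_matrix_classical[OF X] c h refl] entry_alg_sum[OF p]
      unit_labels_classical
    by (subst sum.reindex) (auto simp: inj_on_def entry_def delta_eq_matrix_unit)
  then show ?thesis
    by (simp add: entry_alg_smult[OF p semilinear_maps_in[OF h]]) (simp add: entry_def)
qed

lemma linear_classical_eqI:
  assumes X: "finite X" and g: "g \<in> linear_maps (classical X) D" and h: "h \<in> linear_maps (classical X) D"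
    and eq: "\<And>x. x \<in> X \<Longrightarrow> g (delta X x) = h (delta X x)"
  shows "g = h"
proof (rule extensionalityI[of _ "elements (classical X)"])
  fix c assume c: "c \<in> elements (classical X)"
  show "g c = h c"
    by (rule elements_eqI_index[OF semilinear_maps_in[OF g c] semilinear_maps_in[OF h c]])
      (simp add: linear_classical_index[OF X g c] linear_classical_index[OF X h c] eq)
qed (use g h in \<open>auto simp: semilinear_maps_def PiE_def\<close>)

lemma delta_positive:
  assumes "x \<in> X" shows "delta X x \<in> positive (classical X)"
proof (rule positiveI[where W = "\<lambda>_. {()}" and f = "\<lambda>y _ _. if y = x then 1 else 0"])
  fix y i j assume "i < classical X y" "j < classical X y"
  then show "delta X x y $$ (i, j) =
      (\<Sum>w\<in>{()}. cnj (if y = x then 1 else 0) * (if y = x then 1 else 0))"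
    by (simp add: delta_def)
qed simp_all

section \<open>Blocks of products, channel states and time reversals with a classical factor\<close>

lemma tensor_one_right_block:
  assumes a: "a \<in> elements A" and y: "y \<in> X"
  shows "tensor_elt a (alg_one (classical X)) (Pair x y) = a x"
  using y by (intro eq_matI)
    (simp_all add: tensor_elt_def kronecker_def alg_one_def classical_def elements_dims[OF a])

text \<open>Classical blocks have size 1, so each block here is scalar and commutes with every
  matrix of its size. This gives the commutation hypothesis for channels out of
  \<open>classical X\<close>.\<close>

lemma tensor_one_left_block:
  assumes c: "c \<in> elements (classical X)" and x: "x \<in> X"
  shows "tensor_elt c (alg_one D) (Pair x t) = c x $$ (0, 0) \<cdot>\<^sub>m 1\<^sub>m (D t)"
  using x by (intro eq_matI)
    (simp_all add: tensor_elt_def kronecker_def alg_one_def classical_def elements_dims[OF c])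

lemma trace_left_classical_index:
  assumes B: "multi_matrix B" and X: "finite X" and z: "z \<in> elements (tensor B (classical X))"
    and y: "y \<in> X"
  shows "trace_left B (classical X) z y $$ (0, 0) = (\<Sum>b | B b \<noteq> 0. mat_trace (z (Pair b y)))"
  using y
  by (simp add: trace_left_index[OF B multi_matrix_classical[OF X] z] classical_eq_1 mat_trace_def
      elements_dims[OF z])

text \<open>The only matrix units of \<open>classical X\<close> are the \<open>delta X x\<close>, so
  the channel state is the sum of \<open>tensor_elt (delta X x) (R (delta X x))\<close>.\<close>

lemma channel_state_classical_block:
  assumes X: "finite X" and R: "R \<in> linear_maps (classical X) D" and x: "x \<in> X"
  shows "channel_state (classical X) D R (Pair x t) = R (delta X x) t"
proof (rule eq_matI)
  note el = elements_dims[OF semilinear_maps_in[OF R delta_in]]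
  note cs = elements_dims[OF channel_state_in[OF multi_matrix_classical[OF X] R]]
  show "dim_row (channel_state (classical X) D R (Pair x t)) = dim_row (R (delta X x) t)"
    "dim_col (channel_state (classical X) D R (Pair x t)) = dim_col (R (delta X x) t)"
    using x by (simp_all add: el cs) (simp_all add: classical_def)
  fix i j assume "i < dim_row (R (delta X x) t)" "j < dim_col (R (delta X x) t)"
  then have q: "(t, i, j) \<in> unit_labels D" by (simp add: el unit_labels_iff)
  have p: "(x, 0, 0) \<in> unit_labels (classical X)" using x by (simp add: unit_labels_classical)
  show "channel_state (classical X) D R (Pair x t) $$ (i, j) = R (delta X x) t $$ (i, j)"
    using entry_channel_state[OF multi_matrix_classical[OF X] R p q]
    by (simp add: entry_def pair_label_def delta_eq_matrix_unit)
qed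

text \<open>Entry \<open>(i, j)\<close> is the \<open>y\<close> component of the partial trace of
  the matrix unit E_ji in block \<open>Pair b x\<close>, which is 1 exactly when
  \<open>x = y\<close> and \<open>i = j\<close>.\<close>

lemma channel_state_trace_left_block:
  fixes B :: "'a algebra"
  assumes B: "multi_matrix B" and X: "finite X" and x: "x \<in> X" and y: "y \<in> X"
  defines "T \<equiv> tensor B (classical X)"
  shows "channel_state T (classical X) (trace_left B (classical X)) (Pair (Pair b x) y) =
    (if x = y then 1\<^sub>m (B b) else 0\<^sub>m (B b) (B b))"
proof -
  note C = multi_matrix_classical[OF X]
  note T = multi_matrix_tensor[OF B C, folded T_def]
  note E = conjunct1[OF trace_left[OF B C], folded T_def]
  have dims: "T (Pair b x) = B b" "T (Pair b y) = B b" for b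
    using x y by (simp_all add: T_def classical_def)
  show ?thesis
  proof (rule eq_matI)
    fix i j assume "i < dim_row (if x = y then 1\<^sub>m (B b) else 0\<^sub>m (B b) (B b) :: complex mat)"
      "j < dim_col (if x = y then 1\<^sub>m (B b) else 0\<^sub>m (B b) (B b) :: complex mat)"
    then have ij: "i < B b" "j < B b" by (simp_all split: if_splits)
    have p: "(Pair b x, i, j) \<in> unit_labels T" using ij by (simp add: unit_labels_iff dims)
    have q: "(y, 0, 0) \<in> unit_labels (classical X)" using y by (simp add: unit_labels_classical)
    have "channel_state T (classical X) (trace_left B (classical X)) (Pair (Pair b x) y) $$ (i, j) =
        trace_left B (classical X) (matrix_unit T (Pair b x, j, i)) y $$ (0, 0)"
      using entry_channel_state[OF T E p q] y by (simp add: entry_def pair_label_def classical_def)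
    also have "\<dots> = (\<Sum>b' | B b' \<noteq> 0. mat_trace (matrix_unit T (Pair b x, j, i) (Pair b' y)))"
      by (rule trace_left_classical_index[OF B X _ y]) (simp add: T_def[symmetric])
    also have "\<dots> = (\<Sum>b' | B b' \<noteq> 0. if b' = b then (if x = y \<and> i = j then 1 else 0) else 0)"
    proof (intro sum.cong refl)
      fix b'
      have "mat_trace (matrix_unit T (Pair b x, j, i) (Pair b' y)) =
          (\<Sum>k<B b'. if k = j then (if b' = b \<and> x = y \<and> i = j then 1 else 0) else 0)"
        unfolding mat_trace_def by (rule sum.cong) (auto simp: matrix_unit_def dims)
      then show "mat_trace (matrix_unit T (Pair b x, j, i) (Pair b' y)) =
          (if b' = b then (if x = y \<and> i = j then 1 else 0) else 0)"
        using ij by (simp add: sum.delta)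
    qed
    also have "\<dots> = (if x = y \<and> i = j then 1 else 0)"
      using B ij by (simp add: sum.delta multi_matrix_def)
    finally show "channel_state T (classical X) (trace_left B (classical X)) (Pair (Pair b x) y) $$ (i, j) =
        (if x = y then 1\<^sub>m (B b) else 0\<^sub>m (B b) (B b)) $$ (i, j)"
      using ij by simp
  qed (use y in \<open>simp_all add: elements_dims[OF channel_state_in[OF T E]] dims classical_eq_1\<close>)
qed

text \<open>The classical block has size 1, so the index permutation in
  \<open>time_reversal_index\<close> becomes trivial and only the conjugate transpose
  remains.\<close>

lemma time_reversal_classical_block:
  assumes D: "multi_matrix D" and X: "finite X" and z: "z \<in> elements (tensor (classical X) D)"
    and y: "y \<in> X"
  shows "time_reversal (classical X) D z (Pair t y) = mat_adjoint (z (Pair y t))"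
proof -
  note C = multi_matrix_classical[OF X]
  have "time_reversal (classical X) D z \<in> elements (tensor D (classical X))"
    using semilinear_maps_in[OF conjunct1[OF time_reversal[OF D C]] z] .
  note d = elements_dims[OF this]
  show ?thesis
    using y by (intro eq_matI) (simp_all add: d elements_dims[OF z] time_reversal_index[OF D C z]
      mat_adjoint_index classical_eq_1)
qed

section \<open>The classical limit axiom on the two sides of Bayes' rule\<close>

lemma commutator_zero:
  assumes "a \<in> elements A" "b \<in> elements A" "alg_mult a b = alg_mult b a"
  shows "alg_commutator a b = alg_zero A"
  unfolding alg_commutator_def assms(3)
  by (intro ext eq_matI) (simp_all add: alg_diff_def alg_zero_def
      elements_dims[OF alg_mult_in_elements[OF assms(2,1)]])

lemma classical_limitD:
  assumes "classical_limit star" "multi_matrix A" "multi_matrix B" "\<Phi> \<in> CPTP A B" "\<rho> \<in> states A"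
    and comm: "alg_mult (channel_state A B \<Phi>) (tensor_elt \<rho> (alg_one B)) =
      alg_mult (tensor_elt \<rho> (alg_one B)) (channel_state A B \<Phi>)"
  shows "star A B \<Phi> \<rho> = alg_mult (channel_state A B \<Phi>) (tensor_elt \<rho> (alg_one B))"
proof -
  have "\<Phi> \<in> linear_maps A B" "\<rho> \<in> elements A"
    using assms(4,5) by (auto simp: CPTP_def states_def completely_positive_linear positive_elements)
  then have "alg_commutator (channel_state A B \<Phi>) (tensor_elt \<rho> (alg_one B)) = alg_zero (tensor A B)"
    using assms(2) comm by (intro commutator_zero) (auto simp: channel_state_in tensor_elt_in)
  then show ?thesis using assms unfolding classical_limit_def by blast
qed

text \<open>The left side of Bayes' rule. Each block of the channel state is an identity or zero, so
  it commutes with the block of the state, and the product keeps or deletes that block.\<close>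

lemma star_trace_left_block:
  fixes B :: "'a algebra" and star :: "'a sot"
  assumes B: "multi_matrix B" and X: "finite X" and lim: "classical_limit star"
    and \<rho>: "\<rho> \<in> states (tensor B (classical X))"
  defines "T \<equiv> tensor B (classical X)" and "C \<equiv> classical X"
  shows "star T C (trace_left B C) \<rho> \<in> elements (tensor T C)"
    and "x \<in> X \<Longrightarrow> y \<in> X \<Longrightarrow> star T C (trace_left B C) \<rho> (Pair (Pair b x) y) =
      (if x = y then \<rho> (Pair b x) else 0\<^sub>m (B b) (B b))"
proof -
  note C = multi_matrix_classical[OF X, folded C_def]
  note T = multi_matrix_tensor[OF B C, unfolded C_def, folded T_def]
  have E: "trace_left B C \<in> CPTP T C"
    using trace_left_CPTP[OF B C] by (simp add: T_def C_def)
  then have lin: "trace_left B C \<in> linear_maps T C"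
    by (simp add: CPTP_def completely_positive_linear)
  have \<rho>el: "\<rho> \<in> elements T" using \<rho> by (auto simp: states_def T_def positive_elements)
  let ?D = "channel_state T C (trace_left B C)" and ?r = "tensor_elt \<rho> (alg_one C)"
  note Din = channel_state_in[OF T lin] and rin = tensor_elt_in[OF \<rho>el alg_one_in, of C]
  have rb: "?r (Pair t y) = \<rho> t" if "y \<in> X" for t y
    using tensor_one_right_block[OF \<rho>el that] by (simp add: C_def)
  have Db: "?D (Pair (Pair b x) y) = (if x = y then 1\<^sub>m (B b) else 0\<^sub>m (B b) (B b))"
    if "x \<in> X" "y \<in> X" for b x y
    using channel_state_trace_left_block[OF B X that] by (simp add: T_def C_def)
  have car: "\<rho> (Pair b x) \<in> carrier_mat (B b) (B b)" if "x \<in> X" for b x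
    using \<rho>el that by (auto simp: elements_def T_def classical_def dest: spec[of _ "Pair b x"])
  have "alg_mult ?D ?r = alg_mult ?r ?D"
  proof (rule elements_eqI_block[OF alg_mult_in_elements[OF Din rin] alg_mult_in_elements[OF rin Din]])
    fix v assume "tensor T C v \<noteq> 0"
    then obtain b x y where "v = Pair (Pair b x) y" "x \<in> X" "y \<in> X"
      by (auto simp: tensor_def T_def C_def classical_def split: label.splits if_splits)
    then show "alg_mult ?D ?r v = alg_mult ?r ?D v"
      using left_mult_one_mat[OF car] right_mult_one_mat[OF car] left_mult_zero_mat[OF car]
        right_mult_zero_mat[OF car] by (simp add: alg_mult_def Db rb)
  qed
  from classical_limitD[OF lim T C E \<rho>[folded T_def] this]
  have eq: "star T C (trace_left B C) \<rho> = alg_mult ?D ?r" .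
  show "star T C (trace_left B C) \<rho> \<in> elements (tensor T C)"
    unfolding eq using Din rin by (rule alg_mult_in_elements)
  assume "x \<in> X" "y \<in> X"
  then show "star T C (trace_left B C) \<rho> (Pair (Pair b x) y) =
      (if x = y then \<rho> (Pair b x) else 0\<^sub>m (B b) (B b))"
    unfolding eq using left_mult_one_mat[OF car] left_mult_zero_mat[OF car]
    by (simp add: alg_mult_def Db rb)
qed

text \<open>The right side of Bayes' rule before time reversal. The state contributes the scalar
  \<open>p x $$ (0, 0)\<close> to each block, so commutation holds for every channel
  \<open>R\<close>.\<close>

lemma star_classical_block:
  fixes star :: "'a sot"
  assumes X: "finite X" and D: "multi_matrix D" and lim: "classical_limit star"
    and R: "R \<in> CPTP (classical X) D" and p: "p \<in> states (classical X)"
  shows "star (classical X) D R p \<in> elements (tensor (classical X) D)"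
    and "x \<in> X \<Longrightarrow> star (classical X) D R p (Pair x t) = p x $$ (0, 0) \<cdot>\<^sub>m R (delta X x) t"
proof -
  let ?C = "classical X"
  note C = multi_matrix_classical[OF X]
  have lin: "R \<in> linear_maps ?C D" using R by (simp add: CPTP_def completely_positive_linear)
  have pel: "p \<in> elements ?C" using p by (auto simp: states_def positive_elements)
  let ?D = "channel_state ?C D R" and ?r = "tensor_elt p (alg_one D)"
  note Din = channel_state_in[OF C lin] and rin = tensor_elt_in[OF pel alg_one_in, of D]
  have car: "R (delta X x) t \<in> carrier_mat (D t) (D t)" for x t
    using semilinear_maps_in[OF lin delta_in] by (auto simp: elements_def)
  note blocks = channel_state_classical_block[OF X lin] tensor_one_left_block[OF pel]
  have "alg_mult ?D ?r = alg_mult ?r ?D"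
  proof (rule elements_eqI_block[OF alg_mult_in_elements[OF Din rin] alg_mult_in_elements[OF rin Din]])
    fix v assume "tensor ?C D v \<noteq> 0"
    then obtain x t where "v = Pair x t" "x \<in> X"
      by (auto simp: tensor_def classical_def split: label.splits if_splits)
    then show "alg_mult ?D ?r v = alg_mult ?r ?D v"
      using car[of x t] by (simp add: alg_mult_def blocks mult_smult_distrib[OF car one_carrier_mat]
        mult_smult_assoc_mat[OF one_carrier_mat car])
  qed
  from classical_limitD[OF lim C D R p this]
  have eq: "star ?C D R p = alg_mult ?D ?r" .
  show "star ?C D R p \<in> elements (tensor ?C D)"
    unfolding eq using Din rin by (rule alg_mult_in_elements)
  assume "x \<in> X"
  then show "star ?C D R p (Pair x t) = p x $$ (0, 0) \<cdot>\<^sub>m R (delta X x) t"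
    unfolding eq using car[of x t]
    by (simp add: alg_mult_def blocks mult_smult_distrib[OF car one_carrier_mat])
qed

section \<open>Bayesian inverses of the classical partial trace\<close>

text \<open>Removes the adjoint that time reversal introduces: positive elements are self-adjoint
  and the scalar is real.\<close>

lemma adjoint_smult_positive:
  assumes a: "a \<in> positive A" and c: "cnj c = c"
  shows "mat_adjoint (c \<cdot>\<^sub>m a x) = c \<cdot>\<^sub>m a x"
proof -
  have "mat_adjoint (c \<cdot>\<^sub>m a x) = alg_adjoint (alg_smult c a) x"
    by (simp add: alg_adjoint_def alg_smult_def)
  then show ?thesis
    unfolding alg_adjoint_smult c positive_adjoint[OF a] by (simp add: alg_smult_def)
qed

text \<open>Both sides of Bayes' rule are evaluated by the axiom and compared block by block. The
  adjoint from time reversal drops out because \<open>R (delta X y)\<close> is positive and the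
  components of the state \<open>E \<rho>\<close> are real.\<close>

lemma is_bayesian_inverse_trace_left_iff:
  fixes B :: "'a algebra" and star :: "'a sot"
  defines "T X \<equiv> tensor B (classical X)"
  assumes B: "multi_matrix B" and X: "finite X" and lim: "classical_limit star"
    and \<rho>: "\<rho> \<in> states (T X)"
  shows "is_bayesian_inverse star (T X) (classical X) (trace_left B (classical X)) \<rho> R \<longleftrightarrow>
    R \<in> CPTP (classical X) (T X) \<and> (\<forall>x\<in>X. \<forall>y\<in>X. \<forall>b.
      trace_left B (classical X) \<rho> y $$ (0, 0) \<cdot>\<^sub>m R (delta X y) (Pair b x) =
      (if x = y then \<rho> (Pair b x) else 0\<^sub>m (B b) (B b)))"
proof (cases "R \<in> CPTP (classical X) (T X)")
  case R: True
  let ?C = "classical X" and ?T = "T X"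
  let ?p = "trace_left B ?C \<rho>"
  note C = multi_matrix_classical[OF X]
  note T = multi_matrix_tensor[OF B C, folded T_def]
  have p: "?p \<in> states ?C"
    using CPTP_state[OF T trace_left_CPTP[OF B C, folded T_def] \<rho>] .
  \<comment> \<open>The block of \<open>?p\<close> at \<open>y\<close> has size 1, so this entry is
    the trace of a positive block.\<close>
  have real: "cnj (?p y $$ (0, 0)) = ?p y $$ (0, 0)" if "y \<in> X" for y
  proof -
    have pos: "?p \<in> positive ?C" using p by (simp add: states_def)
    have "mat_trace (?p y) = ?p y $$ (0, 0)"
      using that by (simp add: mat_trace_def elements_dims[OF positive_elements[OF pos]] classical_eq_1)
    then show ?thesis using positive_block_trace(1)[OF pos, of y] by (simp add: Reals_cnj_iff)
  qed
  have pos: "R (delta X y) \<in> positive ?T" if "y \<in> X" for y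
    using R completely_positive_positive[OF C _ delta_positive[OF that]] by (auto simp: CPTP_def)
  note L = star_trace_left_block[OF B X lim \<rho>[unfolded T_def], folded T_def]
  note S = star_classical_block[OF X T lim R p]
  let ?r = "time_reversal ?C ?T (star ?C ?T R ?p)"
  have r_in: "?r \<in> elements (tensor ?T ?C)"
    using semilinear_maps_in[OF conjunct1[OF time_reversal[OF T C]] S(1)] .
  have r: "?r (Pair t y) = ?p y $$ (0, 0) \<cdot>\<^sub>m R (delta X y) t" if y: "y \<in> X" for t y
    unfolding time_reversal_classical_block[OF T X S(1) y] S(2)[OF y]
    by (rule adjoint_smult_positive[OF pos[OF y] real[OF y]])
  have "star ?T ?C (trace_left B ?C) \<rho> = ?r \<longleftrightarrow> (\<forall>x\<in>X. \<forall>y\<in>X. \<forall>b.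
      ?p y $$ (0, 0) \<cdot>\<^sub>m R (delta X y) (Pair b x) =
      (if x = y then \<rho> (Pair b x) else 0\<^sub>m (B b) (B b)))" (is "_ \<longleftrightarrow> ?rhs")
  proof
    assume eq: "star ?T ?C (trace_left B ?C) \<rho> = ?r"
    show ?rhs
    proof (intro ballI allI)
      fix x y b assume x: "x \<in> X" and y: "y \<in> X"
      show "?p y $$ (0, 0) \<cdot>\<^sub>m R (delta X y) (Pair b x) =
          (if x = y then \<rho> (Pair b x) else 0\<^sub>m (B b) (B b))"
        using L(2)[OF x y, of b] r[OF y, of "Pair b x"] eq by simp
    qed
  next
    assume rhs: ?rhs
    show "star ?T ?C (trace_left B ?C) \<rho> = ?r"
    proof (rule elements_eqI_block[OF L(1) r_in])
      fix v assume "tensor ?T ?C v \<noteq> 0"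
      then obtain b x y where "v = Pair (Pair b x) y" "x \<in> X" "y \<in> X"
        by (auto simp: tensor_def T_def classical_def split: label.splits if_splits)
      then show "star ?T ?C (trace_left B ?C) \<rho> v = ?r v"
        using L(2)[of x y b] r[of y "Pair b x"] rhs by simp
    qed
  qed
  then show ?thesis using R by (simp add: is_bayesian_inverse_def)
qed (simp add: is_bayesian_inverse_def)

text \<open>The block traces over \<open>y\<close> are nonnegative and add up to the
  \<open>y\<close> component of \<open>delta X x\<close>, which is zero. Each of them is therefore
  zero, and a positive block of trace zero vanishes.\<close>

lemma positive_trace_left_delta_block:
  assumes B: "multi_matrix B" and X: "finite X" and z: "z \<in> positive (tensor B (classical X))"
    and E: "trace_left B (classical X) z = delta X x" and y: "y \<in> X" "y \<noteq> x"
  shows "z (Pair b y) = 0\<^sub>m (B b) (B b)"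
proof -
  let ?T = "tensor B (classical X)"
  have fin: "finite {b. B b \<noteq> 0}" using B by (simp add: multi_matrix_def)
  have dim: "?T (Pair b y) = B b" using y by (simp add: classical_eq_1)
  have "(\<Sum>b | B b \<noteq> 0. mat_trace (z (Pair b y))) = 0"
    using trace_left_classical_index[OF B X positive_elements[OF z] y(1)] y
    by (simp add: E delta_index)
  \<comment> \<open>Nonnegativity is available for real parts, so the sum is taken there; the traces
    being real brings the result back.\<close>
  then have "(\<Sum>b | B b \<noteq> 0. Re (mat_trace (z (Pair b y)))) = 0"
    by (simp flip: Re_sum)
  then have *: "Re (mat_trace (z (Pair b y))) = 0" if "B b \<noteq> 0" for b
    using sum_nonneg_eq_0_iff[OF fin, of "\<lambda>b. Re (mat_trace (z (Pair b y)))"]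
      positive_block_trace(2)[OF z] that by simp
  show ?thesis
  proof (cases "B b = 0")
    case True
    then show ?thesis
      by (intro eq_matI) (simp_all add: elements_dims[OF positive_elements[OF z]])
  next
    case False
    have "mat_trace (z (Pair b y)) = 0"
      using *[OF False] positive_block_trace(1)[OF z] by (simp add: complex_eq_iff complex_is_Real_iff)
    then show ?thesis using positive_block_trace(3)[OF z, of "Pair b y"] unfolding dim by blast
  qed
qed

section \<open>Comparison of the three maps through one system of block equations\<close>

theorem mainTheorem2:
  fixes A B :: "'a algebra" and X :: "'a label set"
    and \<sigma> \<rho> :: "'a elt"
    and F E \<Psi> \<Omega> :: "'a elt \<Rightarrow> 'a elt"
    and Fx :: "'a label \<Rightarrow> 'a elt \<Rightarrow> 'a elt"
    and star :: "'a sot"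
  assumes "multi_matrix A" and "multi_matrix B" and "finite X"
    and "\<sigma> \<in> states A"
    and "F \<in> CPTP A (tensor B (classical X))"
    and "\<And>x. x \<in> X \<Longrightarrow> Fx x \<in> completely_positive A B"
    and "\<And>a. a \<in> elements A \<Longrightarrow>
           F a = alg_sum (tensor B (classical X)) (\<lambda>x. tensor_elt (Fx x a) (delta X x)) X"
    and "E = trace_left B (classical X)"
    and "\<rho> = F \<sigma>"
    and "\<And>x. x \<in> X \<Longrightarrow> alg_trace B (Fx x \<sigma>) \<noteq> 0"
    and "\<Psi> \<in> linear_maps (classical X) (tensor B (classical X))"
    and "\<And>x. x \<in> X \<Longrightarrow>
           \<Psi> (delta X x) =
             tensor_elt (alg_smult (1 / alg_trace B (Fx x \<sigma>)) (Fx x \<sigma>)) (delta X x)"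
    and "state_over_time_function star" and "classical_limit star"
    and "\<Omega> \<in> CPTP (classical X) (tensor B (classical X))"
    and "\<Omega> (E \<rho>) = \<rho>"
    and "\<And>c. c \<in> elements (classical X) \<Longrightarrow> E (\<Omega> c) = c"
  shows "(\<exists>!R. is_bayesian_inverse star (tensor B (classical X)) (classical X) E \<rho> R) \<and>
         \<Omega> = \<Psi> \<and>
         \<Psi> = bayesian_inverse star (tensor B (classical X)) (classical X) E \<rho>"
proof -
  note [simp] = \<open>E = _\<close>
  let ?C = "classical X" and ?T = "tensor B (classical X)"
  note A = assms(1) and B = assms(2) and X = assms(3)
  note C = multi_matrix_classical[OF X]
  note T = multi_matrix_tensor[OF B C]
  have \<sigma>: "\<sigma> \<in> elements A" using assms(4) by (simp add: states_def positive_elements)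
  have \<rho>: "\<rho> \<in> states ?T" unfolding assms(9) using CPTP_state[OF A assms(5,4)] .
  then have \<rho>el: "\<rho> \<in> elements ?T" by (simp add: states_def positive_elements)
  note E = trace_left_CPTP[OF B C]
  have Elin: "trace_left B ?C \<in> linear_maps ?T ?C"
    using E by (simp add: CPTP_def completely_positive_linear)
  note pel = semilinear_maps_in[OF Elin \<rho>el]
  have Fel: "Fx x \<sigma> \<in> elements B" if "x \<in> X" for x
    using semilinear_maps_in[OF completely_positive_linear[OF assms(6)[OF that]] \<sigma>] .
  have dim: "?T (Pair b x) = B b" if "x \<in> X" for b x using that by (simp add: classical_eq_1)
  have \<rho>b: "\<rho> (Pair b x) = Fx x \<sigma> b" if x: "x \<in> X" for b x
  proof (rule eq_matI)
    fix i j assume "i < dim_row (Fx x \<sigma> b)" "j < dim_col (Fx x \<sigma> b)"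
    then have ij: "i < B b" "j < B b" by (simp_all add: elements_dims[OF Fel[OF x]])
    have "\<rho> (Pair b x) $$ (i, j) = (\<Sum>y\<in>X. tensor_elt (Fx y \<sigma>) (delta X y) (Pair b x) $$ (i, j))"
      unfolding assms(9) assms(7)[OF \<sigma>] alg_sum_def using ij x by (simp add: classical_eq_1)
    \<comment> \<open>The factor \<open>delta X y\<close> vanishes at \<open>x\<close> unless
      \<open>y = x\<close>.\<close>
    also have "\<dots> = (\<Sum>y\<in>X. if y = x then Fx x \<sigma> b $$ (i, j) else 0)"
      using ij x by (intro sum.cong refl)
        (auto simp: tensor_elt_index[OF Fel delta_in] classical_eq_1 delta_index)
    finally show "\<rho> (Pair b x) $$ (i, j) = Fx x \<sigma> b $$ (i, j)"
      using x X by (simp add: sum.delta)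
  qed (use x in \<open>simp_all add: elements_dims[OF \<rho>el] dim elements_dims[OF Fel] del: tensor_Pair\<close>)
  \<comment> \<open>The probability of outcome \<open>x\<close>; it is also the component of
    \<open>E \<rho>\<close> at \<open>x\<close>.\<close>
  define p where "p x = alg_trace B (Fx x \<sigma>)" for x
  have p0: "p x \<noteq> 0" if "x \<in> X" for x using assms(10)[OF that] by (simp add: p_def)
  have p: "trace_left B ?C \<rho> x $$ (0, 0) = p x" if "x \<in> X" for x
    by (simp add: trace_left_classical_index[OF B X \<rho>el that] \<rho>b[OF that] p_def alg_trace_def)
  \<comment> \<open>Multiplying by \<open>p y\<close> clears the normalisation in
    \<open>\<Psi>\<close> and yields the very equations that characterise a Bayesian
    inverse.\<close>
  have \<Psi>b: "p y \<cdot>\<^sub>m \<Psi> (delta X y) (Pair b x) = (if x = y then \<rho> (Pair b x) else 0\<^sub>m (B b) (B b))"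
    if x: "x \<in> X" and y: "y \<in> X" for x y b
    using x p0[OF y] unfolding assms(12)[OF y] p_def[symmetric] \<rho>b[OF x] tensor_elt_smult_left
    by (intro eq_matI) (auto simp: alg_smult_def tensor_elt_index[OF Fel[OF y] delta_in]
      elements_dims[OF tensor_elt_in[OF Fel[OF y] delta_in]] elements_dims[OF Fel[OF x]]
      elements_dims[OF Fel[OF y]] classical_eq_1 delta_index)
  \<comment> \<open>Since \<open>p y\<close> is nonzero, the block equations have at most one linear
    solution. This is applied both to \<open>\<Omega>\<close> and to an arbitrary Bayesian
    inverse.\<close>
  have unique: "R = \<Psi>" if R: "R \<in> linear_maps ?C ?T"
    and Rb: "\<And>x y b. x \<in> X \<Longrightarrow> y \<in> X \<Longrightarrow> p y \<cdot>\<^sub>m R (delta X y) (Pair b x) =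
      (if x = y then \<rho> (Pair b x) else 0\<^sub>m (B b) (B b))" for R
  proof (rule linear_classical_eqI[OF X R assms(11)])
    fix y assume y: "y \<in> X"
    note el = semilinear_maps_in[OF R delta_in, of y] semilinear_maps_in[OF assms(11) delta_in, of y]
    show "R (delta X y) = \<Psi> (delta X y)"
    proof (rule elements_eqI_index[OF el])
      fix v i j assume v: "i < ?T v" "j < ?T v"
      then obtain b x where vx: "v = Pair b x" "x \<in> X"
        by (auto simp: tensor_def classical_def split: label.splits if_splits)
      have "p y \<cdot>\<^sub>m R (delta X y) v = p y \<cdot>\<^sub>m \<Psi> (delta X y) v"
        using Rb[OF vx(2) y] \<Psi>b[OF vx(2) y] by (simp add: vx(1))
      from arg_cong[OF this, of "\<lambda>M. M $$ (i, j)"]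
      show "R (delta X y) v $$ (i, j) = \<Psi> (delta X y) v $$ (i, j)"
        using v p0[OF y] by (simp add: elements_dims[OF el(1)] elements_dims[OF el(2)])
    qed
  qed
  have \<Omega>lin: "\<Omega> \<in> linear_maps ?C ?T"
    using assms(15) by (simp add: CPTP_def completely_positive_linear)
  have \<Omega>pos: "\<Omega> (delta X y) \<in> positive ?T" if "y \<in> X" for y
    using assms(15) completely_positive_positive[OF C _ delta_positive[OF that]] by (auto simp: CPTP_def)
  have \<Omega>0: "\<Omega> (delta X y) (Pair b x) = 0\<^sub>m (B b) (B b)" if "x \<in> X" "y \<in> X" "x \<noteq> y" for x y b
    using positive_trace_left_delta_block[OF B X \<Omega>pos _ that(1,3)] assms(17)[OF delta_in] that(2)
    by simp
  have \<Omega>b: "p y \<cdot>\<^sub>m \<Omega> (delta X y) (Pair b x) = (if x = y then \<rho> (Pair b x) else 0\<^sub>m (B b) (B b))"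
    if x: "x \<in> X" and y: "y \<in> X" for x y b
  proof (cases "x = y")
    case True
    note el = semilinear_maps_in[OF \<Omega>lin delta_in, of y]
    have "\<rho> (Pair b y) = p y \<cdot>\<^sub>m \<Omega> (delta X y) (Pair b y)"
    proof (rule eq_matI)
      fix i j assume "i < dim_row (p y \<cdot>\<^sub>m \<Omega> (delta X y) (Pair b y))"
        "j < dim_col (p y \<cdot>\<^sub>m \<Omega> (delta X y) (Pair b y))"
      then have ij: "i < ?T (Pair b y)" "j < ?T (Pair b y)" by (simp_all add: elements_dims[OF el])
      then have ij': "i < B b" "j < B b" using y by (simp_all add: classical_eq_1)
      \<comment> \<open>Expand \<open>\<Omega> (E \<rho>) = \<rho>\<close> along the
        \<open>delta X x\<close>: over \<open>y\<close>, all terms but the one for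
        \<open>x = y\<close> vanish by \<open>\<Omega>0\<close>.\<close>
      have "\<rho> (Pair b y) $$ (i, j) = \<Omega> (trace_left B ?C \<rho>) (Pair b y) $$ (i, j)"
        using assms(16) by simp
      also have "\<dots> = (\<Sum>x\<in>X. p x * \<Omega> (delta X x) (Pair b y) $$ (i, j))"
        unfolding linear_classical_index[OF X \<Omega>lin pel ij] by (simp add: p)
      also have "\<dots> = (\<Sum>x\<in>X. if x = y then p y * \<Omega> (delta X y) (Pair b y) $$ (i, j) else 0)"
        using \<Omega>0[OF y] ij' by (intro sum.cong refl) auto
      finally show "\<rho> (Pair b y) $$ (i, j) = (p y \<cdot>\<^sub>m \<Omega> (delta X y) (Pair b y)) $$ (i, j)"
        using y X ij by (simp add: sum.delta elements_dims[OF el])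
    qed (simp_all add: elements_dims[OF \<rho>el] elements_dims[OF el])
    then show ?thesis using True by simp
  next
    case False
    then show ?thesis using \<Omega>0[OF x y] by (auto intro!: eq_matI)
  qed
  have iff: "is_bayesian_inverse star ?T ?C E \<rho> R \<longleftrightarrow> R \<in> CPTP ?C ?T \<and>
      (\<forall>x\<in>X. \<forall>y\<in>X. \<forall>b. p y \<cdot>\<^sub>m R (delta X y) (Pair b x) =
        (if x = y then \<rho> (Pair b x) else 0\<^sub>m (B b) (B b)))" for R
    using is_bayesian_inverse_trace_left_iff[OF B X assms(14) \<rho>, of R] p by simp
  have \<Omega>\<Psi>: "\<Omega> = \<Psi>" using unique[OF \<Omega>lin \<Omega>b] .
  \<comment> \<open>\<open>\<Psi>\<close> is introduced only as a linear map; that it is a channel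
    comes from \<open>\<Omega> = \<Psi>\<close>.\<close>
  have inv: "is_bayesian_inverse star ?T ?C E \<rho> \<Psi>"
    unfolding iff using assms(15) \<Psi>b by (simp add: \<Omega>\<Psi>)
  have only: "R = \<Psi>" if "is_bayesian_inverse star ?T ?C E \<rho> R" for R
    using that unfolding iff by (intro unique) (auto simp: CPTP_def completely_positive_linear)
  have bayes: "bayesian_inverse star ?T ?C E \<rho> = \<Psi>"
    unfolding bayesian_inverse_def using inv only by (rule the_equality)
  show ?thesis
    by (intro conjI ex1I[of _ \<Psi>] inv only \<Omega>\<Psi> bayes[symmetric])
qed

end
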